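(* Let $q$ be a prime power, $k\ge 2$, $n=[k]_q$, $V=\mathbb{F}_q^n$, and $m\in\{0,1,\dots,k-1\}$. Every $m$-dimensional subspace of $V$ that is contained in some $q$-ary simplex code of dimension $k$ is contained in precisely $$\frac{N!\,(q-1)^{N}\,\big((q^{k-m})!\big)^{[m]_q}}{(q^{k-m}-1)(q^{k-m}-q)\cdots(q^{k-m}-q^{k-m-1})\,q^{m(k-m)}},\qquad N=[k-m]_q,$$ distinct $q$-ary simplex codes of dimension $k$ in $V$. Furthermore, unless $q=k=2$, for every such $m$-dimensional subspace $X$ there exist two simplex codes $C,C'\subseteq V$ of dimension $k$ with $C\cap C'=X$.
   Context: For a natural number $s$, $[s]_q=\frac{q^s-1}{q-1}$ (with $[0]_q=0$). A $k$-dimensional subspace $C\subseteq V=\mathbb{F}_q^n$ with $n=[k]_q$ is a $q$-ary simplex code of dimension $k$ if the columns of a generator matrix of $C$ (a $k\times n$ matrix whose rows form a basis of $C$) are non-zero and mutually non-proportional. *)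

theory Defs
  imports "HOL-Analysis.Cartesian_Space"
begin

text \<open>
  Throughout, the finite field with \<open>q\<close> elements is a type \<open>'a :: {field, finite}\<close> with
  \<open>CARD('a) = q\<close>, and the space of row vectors of length \<open>n\<close> is \<open>'a ^ 'n\<close> with \<open>CARD('n) = n\<close>.
\<close>

text \<open>The division is exact for \<open>q \<ge> 2\<close>.\<close>

definition q_number :: "nat \<Rightarrow> nat \<Rightarrow> nat"
  where "q_number q s = (q ^ s - 1) div (q - 1)"

text \<open>
  A matrix with \<open>k\<close> rows is given by its rows \<open>G 0, \<dots>, G (k - 1)\<close>, so that its entry in row \<open>i\<close>
  and column \<open>j\<close> is \<open>G i $ j\<close>; the values \<open>G i\<close> for \<open>i \<ge> k\<close> are irrelevant.
\<close>

definition generator_matrix ::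
    "nat \<Rightarrow> (nat \<Rightarrow> 'a::field ^ 'n::finite) \<Rightarrow> ('a ^ 'n) set \<Rightarrow> bool"
  where "generator_matrix k G C \<longleftrightarrow>
    inj_on G {..<k} \<and> vec.independent (G ` {..<k}) \<and> vec.span (G ` {..<k}) = C"

definition nonzero_column :: "nat \<Rightarrow> (nat \<Rightarrow> 'a::field ^ 'n::finite) \<Rightarrow> 'n \<Rightarrow> bool"
  where "nonzero_column k G j \<longleftrightarrow> (\<exists>i<k. G i $ j \<noteq> 0)"

text \<open>Only used for nonzero columns, where this relation is symmetric.\<close>

definition proportional_columns ::
    "nat \<Rightarrow> (nat \<Rightarrow> 'a::field ^ 'n::finite) \<Rightarrow> 'n \<Rightarrow> 'n \<Rightarrow> bool"
  where "proportional_columns k G j j' \<longleftrightarrow> (\<exists>c. \<forall>i<k. G i $ j' = c * G i $ j)"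

definition simplex_code :: "nat \<Rightarrow> ('a::{field,finite} ^ 'n::finite) set \<Rightarrow> bool"
  where "simplex_code k C \<longleftrightarrow>
    CARD('n) = q_number CARD('a) k \<and>
    vec.subspace C \<and> vec.dim C = k \<and>
    (\<exists>G. generator_matrix k G C \<and>
      (\<forall>j. nonzero_column k G j) \<and>
      (\<forall>j j'. j \<noteq> j' \<longrightarrow> \<not> proportional_columns k G j j'))"

end

theory Submission
  imports Defs
begin

text \<open>
  Since \<open>n = [k]\<^sub>q\<close>, the columns of a generator matrix of a simplex code represent every point of
  the projective space of \<open>F\<^sub>q\<^sup>k\<close> exactly once. Fix a basis of \<open>X\<close> and count the matrices with such
  columns whose first \<open>m\<close> rows are that basis. Columns whose top parts (the first \<open>m\<close> entries) are
  not proportional do not interact: the \<open>[k - m]\<^sub>q\<close> columns with zero top contribute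
  \<open>N! (q - 1)\<^sup>N\<close>, and each of the \<open>[m]\<^sub>q\<close> classes of proportional nonzero tops consists of
  \<open>q\<^sup>k\<^sup>-\<^sup>m\<close> columns and contributes \<open>(q\<^sup>k\<^sup>-\<^sup>m)!\<close>. Each code containing \<open>X\<close> arises from as many
  matrices as the basis of \<open>X\<close> has extensions to a basis of the code.

  For the intersection statement, apply to the columns of a simplex matrix an injective map \<open>\<sigma>\<close> of
  \<open>F\<^sub>q\<^sup>k\<close> that commutes with scalars and fixes the first \<open>m\<close> entries. A common codeword of the two
  codes yields linear forms with \<open>l = l' \<circ> \<sigma>\<close>; if \<open>\<sigma>\<close> is sufficiently nonlinear, such an \<open>l\<close>
  involves the first \<open>m\<close> entries only.
\<close>

subsection \<open>Row spaces and simplex matrices\<close>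

definition lincomb :: "nat \<Rightarrow> (nat \<Rightarrow> 'a::field) \<Rightarrow> (nat \<Rightarrow> 'a ^ 'n::finite) \<Rightarrow> 'a ^ 'n"
  where "lincomb k l G = (\<Sum>i<k. l i *s G i)"

definition rows_independent :: "nat \<Rightarrow> (nat \<Rightarrow> 'a::field ^ 'n::finite) \<Rightarrow> bool"
  where "rows_independent k G \<longleftrightarrow> (\<forall>l. lincomb k l G = 0 \<longrightarrow> (\<forall>i<k. l i = 0))"

definition simplex_matrix :: "nat \<Rightarrow> (nat \<Rightarrow> 'a::field ^ 'n::finite) \<Rightarrow> bool"
  where "simplex_matrix k G \<longleftrightarrow> (\<forall>j. nonzero_column k G j) \<and>
    (\<forall>j j'. j \<noteq> j' \<longrightarrow> \<not> proportional_columns k G j j')"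

lemma lincomb_nth: "lincomb k l G $ j = (\<Sum>i<k. l i * G i $ j)"
  by (simp add: lincomb_def)

lemma lincomb_diff: "lincomb k (\<lambda>i. l i - l' i) G = lincomb k l G - lincomb k l' G"
  by (simp add: lincomb_def sum_subtractf vec.scale_left_diff_distrib)

lemma sum_delta_lessThan:
  "(\<Sum>i<(k::nat). (if i = p then c else 0) * f i) = (if p < k then c * f p else (0::'a::field))"
proof -
  have "(\<Sum>i<k. (if i = p then c else 0) * f i) = (\<Sum>i<k. if i = p then c * f i else 0)"
    by (rule sum.cong) auto
  then show ?thesis by simp
qed

lemma lincomb_unit: "p < k \<Longrightarrow> lincomb k (\<lambda>i. if i = p then 1 else 0) G = G p"
  by (simp add: vec_eq_iff lincomb_nth sum_delta_lessThan)

lemma span_rows: "vec.span (G ` {..<k}) = range (\<lambda>l. lincomb k l G)"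
proof
  have "vec.subspace (range (\<lambda>l. lincomb k l G))"
    unfolding vec.subspace_def
  proof (intro conjI ballI allI)
    show "0 \<in> range (\<lambda>l. lincomb k l G)"
      by (rule range_eqI[of _ _ "\<lambda>_. 0"]) (simp add: lincomb_def)
  next
    fix x y assume "x \<in> range (\<lambda>l. lincomb k l G)" "y \<in> range (\<lambda>l. lincomb k l G)"
    then obtain l l' where "x = lincomb k l G" "y = lincomb k l' G" by auto
    then show "x + y \<in> range (\<lambda>l. lincomb k l G)"
      by (intro range_eqI[of _ _ "\<lambda>i. l i + l' i"])
        (simp add: lincomb_def sum.distrib vec.scale_left_distrib)
  next
    fix c x assume "x \<in> range (\<lambda>l. lincomb k l G)"
    then obtain l where "x = lincomb k l G" by auto
    then show "c *s x \<in> range (\<lambda>l. lincomb k l G)"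
      by (intro range_eqI[of _ _ "\<lambda>i. c * l i"])
        (simp add: lincomb_def vec.scale_sum_right)
  qed
  moreover have "G ` {..<k} \<subseteq> range (\<lambda>l. lincomb k l G)"
    using lincomb_unit by (metis (no_types, lifting) image_subsetI lessThan_iff rangeI)
  ultimately show "vec.span (G ` {..<k}) \<subseteq> range (\<lambda>l. lincomb k l G)"
    by (rule vec.span_minimal[rotated])
  show "range (\<lambda>l. lincomb k l G) \<subseteq> vec.span (G ` {..<k})"
    by (auto simp: lincomb_def intro!: vec.span_sum intro: vec.span_scale vec.span_base)
qed

lemma rows_independent_iff:
  "rows_independent k G \<longleftrightarrow> inj_on G {..<k} \<and> vec.independent (G ` {..<k})"
proof
  assume ind: "rows_independent k G"
  have inj: "inj_on G {..<k}"
  proof (rule inj_onI)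
    fix p p' assume p: "p \<in> {..<k}" "p' \<in> {..<k}" "G p = G p'"
    let ?l = "\<lambda>i. (if i = p then 1 else 0) - (if i = p' then 1 else (0::'a))"
    have "lincomb k ?l G = 0"
      unfolding lincomb_diff using p by (simp add: lincomb_unit)
    then have "?l p = 0"
      using ind p(1) unfolding rows_independent_def by blast
    then show "p = p'" by (auto split: if_splits)
  qed
  moreover have "vec.independent (G ` {..<k})"
  proof
    assume "vec.dependent (G ` {..<k})"
    then obtain u v where u: "v \<in> G ` {..<k}" "u v \<noteq> 0" "(\<Sum>v\<in>G ` {..<k}. u v *s v) = 0"
      by (auto simp: vec.dependent_finite)
    have "lincomb k (\<lambda>i. u (G i)) G = 0"
      using u(3) by (simp add: lincomb_def sum.reindex[OF inj])
    then show False using ind u(1,2) unfolding rows_independent_def by auto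
  qed
  ultimately show "inj_on G {..<k} \<and> vec.independent (G ` {..<k})" ..
next
  assume R: "inj_on G {..<k} \<and> vec.independent (G ` {..<k})"
  show "rows_independent k G"
    unfolding rows_independent_def
  proof (intro allI impI)
    fix l i assume l: "lincomb k l G = 0" and i: "i < k"
    let ?g = "the_inv_into {..<k} G"
    have "(\<Sum>v\<in>G ` {..<k}. l (?g v) *s v) = lincomb k l G"
      using R by (simp add: sum.reindex lincomb_def the_inv_into_f_f)
    then have "\<forall>v\<in>G ` {..<k}. l (?g v) = 0"
      using R l by (auto simp: vec.dependent_finite)
    then show "l i = 0" using R i by (auto simp: the_inv_into_f_f)
  qed
qed

lemma lincomb_eq_iff:
  assumes "rows_independent k G"
  shows "lincomb k l G = lincomb k l' G \<longleftrightarrow> (\<forall>i<k. l i = l' i)"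
proof
  assume "lincomb k l G = lincomb k l' G"
  then have "lincomb k (\<lambda>i. l i - l' i) G = 0" by (simp add: lincomb_diff)
  then show "\<forall>i<k. l i = l' i" using assms unfolding rows_independent_def by fastforce
qed (simp add: lincomb_def)

lemma card_span_rows:
  fixes G :: "nat \<Rightarrow> 'a::{field,finite} ^ 'n::finite"
  assumes "rows_independent k G"
  shows "card (vec.span (G ` {..<k})) = CARD('a) ^ k"
proof -
  have "bij_betw (\<lambda>l. lincomb k l G) ({..<k} \<rightarrow>\<^sub>E UNIV) (vec.span (G ` {..<k}))"
    unfolding bij_betw_def
  proof
    show "inj_on (\<lambda>l. lincomb k l G) ({..<k} \<rightarrow>\<^sub>E UNIV)"
      by (rule inj_onI) (metis PiE_ext lessThan_iff lincomb_eq_iff[OF assms])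
    have "lincomb k l G \<in> (\<lambda>l. lincomb k l G) ` ({..<k} \<rightarrow>\<^sub>E UNIV)" for l
      by (rule image_eqI[of _ _ "restrict l {..<k}"]) (auto simp: lincomb_def)
    then show "(\<lambda>l. lincomb k l G) ` ({..<k} \<rightarrow>\<^sub>E UNIV) = vec.span (G ` {..<k})"
      unfolding span_rows by blast
  qed
  then show ?thesis
    by (simp flip: bij_betw_same_card add: card_PiE)
qed

lemma dim_span_rows: "rows_independent k G \<Longrightarrow> vec.dim (vec.span (G ` {..<k})) = k"
  by (simp add: rows_independent_iff vec.dim_eq_card_independent card_image)

lemma rows_of_subspace:
  fixes X :: "('a::field ^ 'n::finite) set"
  assumes "vec.subspace X"
  obtains x where "rows_independent (vec.dim X) x" "vec.span (x ` {..<vec.dim X}) = X"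
proof -
  obtain B where B: "B \<subseteq> X" "vec.independent B" "X \<subseteq> vec.span B" "card B = vec.dim X"
    by (rule vec.basis_exists)
  have "finite B" using B(2) by (rule vec.finiteI_independent)
  then obtain x where x: "bij_betw x {..<vec.dim X} B"
    using B(4) ex_bij_betw_nat_finite by (metis atLeast0LessThan)
  show thesis
  proof
    show "rows_independent (vec.dim X) x"
      using x B by (auto simp: rows_independent_iff bij_betw_def)
    have "vec.span B = X"
      using B(1,3) assms by (meson subset_antisym vec.span_minimal)
    then show "vec.span (x ` {..<vec.dim X}) = X" using x by (simp add: bij_betw_def)
  qed
qed

lemma q_number_mult:
  assumes "q \<ge> 2"
  shows "q_number q k * (q - 1) = q ^ k - 1"
proof -
  have "(q - 1) dvd (q ^ k - 1)"
  proof (cases "k = 0")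
    case False
    then have "int (q ^ k - 1) = (int q - 1) * (\<Sum>i<k. int q ^ i)"
      using assms power_diff_1_eq[of "int q" k] by (simp add: of_nat_diff)
    moreover have "int (q - 1) = int q - 1" using assms by simp
    ultimately show ?thesis by (metis dvd_triv_left int_dvd_int_iff)
  qed simp
  then show ?thesis by (simp add: q_number_def)
qed

lemma CARD_field_ge_2: "CARD('a::{field,finite}) \<ge> 2"
proof -
  have "card {0, 1 :: 'a} \<le> CARD('a)" by (rule card_mono) auto
  then show ?thesis by simp
qed

lemma simplex_matrix_columns_cover:
  fixes G :: "nat \<Rightarrow> 'a::{field,finite} ^ 'n::finite"
  assumes G: "simplex_matrix k G" and n: "CARD('n) = q_number CARD('a) k"
    and w: "\<exists>i<k. w i \<noteq> 0"
  obtains j c where "c \<noteq> 0" "\<And>i. i < k \<Longrightarrow> w i = c * G i $ j"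
proof -
  let ?f = "\<lambda>(j::'n, c). \<lambda>i\<in>{..<k}. c * G i $ j"
  let ?D = "(UNIV::'n set) \<times> (UNIV - {0::'a})"
  let ?R = "({..<k} \<rightarrow>\<^sub>E (UNIV::'a set)) - {\<lambda>i\<in>{..<k}. 0}"
  have "inj_on ?f ?D"
  proof (rule inj_onI)
    fix z z' assume "z \<in> ?D" "z' \<in> ?D" and eq: "?f z = ?f z'"
    then obtain j c j' c' where z: "z = (j, c)" "z' = (j', c')" and c: "c \<noteq> 0" "c' \<noteq> 0"
      by auto
    have e: "(\<lambda>i\<in>{..<k}. c * G i $ j) = (\<lambda>i\<in>{..<k}. c' * G i $ j')"
      using eq by (simp add: z)
    have e': "c * G i $ j = c' * G i $ j'" if "i < k" for i
      using fun_cong[OF e, of i] that by simp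
    then have "G i $ j' = (c / c') * G i $ j" if "i < k" for i
      using that c by (simp add: field_simps)
    then have "proportional_columns k G j j'"
      unfolding proportional_columns_def by blast
    then have j: "j = j'" using G unfolding simplex_matrix_def by blast
    obtain i where "i < k" "G i $ j \<noteq> 0"
      using G unfolding simplex_matrix_def nonzero_column_def by blast
    then show "z = z'" using e'[of i] j by (simp add: z)
  qed
  then have "card (?f ` ?D) = CARD('n) * (CARD('a) - 1)"
    by (simp add: card_image card_cartesian_product card_Diff_singleton)
  also have "\<dots> = card ?R"
    using q_number_mult[OF CARD_field_ge_2] n by (simp add: card_Diff_singleton card_PiE)
  finally have "card (?f ` ?D) = card ?R" .
  moreover have "?f ` ?D \<subseteq> ?R"
  proof (rule image_subsetI)
    fix z assume "z \<in> ?D"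
    then obtain j c where z: "z = (j, c)" and c: "c \<noteq> 0" by auto
    obtain i where "i < k" "G i $ j \<noteq> 0"
      using G unfolding simplex_matrix_def nonzero_column_def by blast
    then have "(\<lambda>i\<in>{..<k}. c * G i $ j) i \<noteq> (\<lambda>i\<in>{..<k}. 0) i" using c by simp
    then have "(\<lambda>i\<in>{..<k}. c * G i $ j) \<noteq> (\<lambda>i\<in>{..<k}. 0)" by metis
    then show "?f z \<in> ?R" by (simp add: z)
  qed
  moreover have "finite ?R" by (simp add: finite_PiE)
  ultimately have "?f ` ?D = ?R" by (metis card_subset_eq)
  moreover have "restrict w {..<k} \<in> ?R"
    using w by (auto simp: fun_eq_iff restrict_def split: if_splits)
  ultimately have "restrict w {..<k} \<in> ?f ` ?D" by argo
  then obtain j c where "c \<noteq> 0" and e: "restrict w {..<k} = ?f (j, c)" by auto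
  moreover have "w i = c * G i $ j" if "i < k" for i
    using fun_cong[OF e, of i] that by simp
  ultimately show thesis using that by blast
qed

lemma simplex_matrix_rows_independent:
  fixes G :: "nat \<Rightarrow> 'a::{field,finite} ^ 'n::finite"
  assumes G: "simplex_matrix k G" and n: "CARD('n) = q_number CARD('a) k"
  shows "rows_independent k G"
  unfolding rows_independent_def
proof (intro allI impI)
  fix l p assume l: "lincomb k l G = 0" and p: "p < k"
  let ?w = "\<lambda>i. if i = p then 1 else (0::'a)"
  have "\<exists>i<k. ?w i \<noteq> 0" using p by auto
  from simplex_matrix_columns_cover[OF G n this] obtain c j
    where c: "c \<noteq> 0" "\<And>i. i < k \<Longrightarrow> ?w i = c * G i $ j" by metis
  have "l p = (\<Sum>i<k. ?w i * l i)" using p by (simp add: sum_delta_lessThan)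
  also have "\<dots> = (\<Sum>i<k. c * (l i * G i $ j))"
    by (rule sum.cong) (auto simp only: c lessThan_iff mult.assoc mult.commute mult.left_commute)
  also have "\<dots> = c * (lincomb k l G $ j)" by (simp add: lincomb_nth sum_distrib_left)
  finally show "l p = 0" by (simp add: l)
qed

lemma simplex_code_span_rows:
  fixes G :: "nat \<Rightarrow> 'a::{field,finite} ^ 'n::finite"
  assumes "simplex_matrix k G" and "CARD('n) = q_number CARD('a) k"
  shows "simplex_code k (vec.span (G ` {..<k}))"
proof -
  have i: "rows_independent k G" using assms by (rule simplex_matrix_rows_independent)
  show ?thesis
    unfolding simplex_code_def generator_matrix_def
    using assms i dim_span_rows[OF i]
    by (auto simp: rows_independent_iff simplex_matrix_def)
qed

lemma simplex_matrix_if_spans_simplex_code: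
  fixes C :: "('a::{field,finite} ^ 'n::finite) set"
  assumes C: "simplex_code k C" and G: "vec.span (G ` {..<k}) = C"
  shows "simplex_matrix k G"
proof -
  obtain H where H: "vec.span (H ` {..<k}) = C" "simplex_matrix k H"
    using C unfolding simplex_code_def generator_matrix_def simplex_matrix_def by auto
  have "H i \<in> vec.span (G ` {..<k})" if "i < k" for i
    using that G H(1) by (metis image_eqI lessThan_iff vec.span_base)
  then have "\<forall>i<k. \<exists>l. H i = lincomb k l G" unfolding span_rows by auto
  then obtain l where l: "\<And>i. i < k \<Longrightarrow> H i = lincomb k (l i) G" by metis
  show ?thesis
    unfolding simplex_matrix_def
  proof (intro conjI allI impI)
    fix j
    obtain i where i: "i < k" "H i $ j \<noteq> 0"
      using H(2) unfolding simplex_matrix_def nonzero_column_def by blast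
    then show "nonzero_column k G j"
      unfolding nonzero_column_def using l[OF i(1)]
      by (metis (no_types, lifting) lessThan_iff lincomb_nth mult_zero_right sum.neutral)
  next
    fix j j' :: 'n assume "j \<noteq> j'"
    show "\<not> proportional_columns k G j j'"
    proof
      assume "proportional_columns k G j j'"
      then obtain c where c: "\<And>i. i < k \<Longrightarrow> G i $ j' = c * G i $ j"
        unfolding proportional_columns_def by blast
      have "H i $ j' = c * H i $ j" if "i < k" for i
        using that by (simp add: l lincomb_nth c sum_distrib_left mult.left_commute)
      then have "proportional_columns k H j j'" unfolding proportional_columns_def by blast
      then show False using H(2) \<open>j \<noteq> j'\<close> unfolding simplex_matrix_def by blast
    qed
  qed
qed

subsection \<open>Matrices per code\<close>

lemma card_extension:
  assumes "S \<subseteq> extensional J" and "j \<notin> J" and "finite S"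
    and "\<And>f. f \<in> S \<Longrightarrow> finite (W f)" and "\<And>f. f \<in> S \<Longrightarrow> card (W f) = h"
  shows "card {f(j := w) |f w. f \<in> S \<and> w \<in> W f} = card S * h"
proof -
  have "inj_on (\<lambda>(f, w). f(j := w)) (Sigma S W)"
  proof (rule inj_onI, clarify)
    fix f w f' w'
    assume f: "f \<in> S" "f' \<in> S" and e: "f(j := w) = f'(j := w')"
    have "f i = f' i" for i
    proof (cases "i = j")
      case True
      then show ?thesis using f assms(1,2) by (metis extensional_arb subsetD)
    next
      case False
      then show ?thesis using fun_cong[OF e, of i] by simp
    qed
    moreover have "w = w'" using fun_cong[OF e, of j] by simp
    ultimately show "f = f' \<and> w = w'" by auto
  qed
  moreover have "{f(j := w) |f w. f \<in> S \<and> w \<in> W f} = (\<lambda>(f, w). f(j := w)) ` Sigma S W"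
    by auto
  ultimately have "card {f(j := w) |f w. f \<in> S \<and> w \<in> W f} = card (Sigma S W)"
    by (simp add: card_image)
  then show ?thesis using assms by simp
qed

lemma rows_independent_Suc:
  "rows_independent (Suc p) G \<longleftrightarrow> rows_independent p G \<and> G p \<notin> vec.span (G ` {..<p})"
  by (auto simp: rows_independent_iff lessThan_Suc vec.independent_insert vec.span_base)

definition basis_extensions ::
    "(nat \<Rightarrow> 'a::field ^ 'n::finite) \<Rightarrow> nat \<Rightarrow> ('a ^ 'n) set \<Rightarrow> nat \<Rightarrow> (nat \<Rightarrow> 'a ^ 'n) set"
  where "basis_extensions x m C p = {G \<in> extensional {..<p}.
    (\<forall>i<m. G i = x i) \<and> G ` {..<p} \<subseteq> C \<and> rows_independent p G}"

lemma finite_basis_extensions: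
  "finite (basis_extensions x m (C :: ('a::{field,finite} ^ 'n::finite) set) p)"
proof (rule finite_subset)
  show "basis_extensions x m C p \<subseteq> {..<p} \<rightarrow>\<^sub>E UNIV"
    by (auto simp: basis_extensions_def PiE_def)
qed (simp add: finite_PiE)

lemma card_basis_extensions:
  fixes C :: "('a::{field,finite} ^ 'n::finite) set"
  assumes C: "vec.subspace C" "card C = CARD('a) ^ k"
    and x: "rows_independent m x" "x ` {..<m} \<subseteq> C" and p: "m \<le> p"
  shows "card (basis_extensions x m C p) = (\<Prod>i=m..<p. CARD('a) ^ k - CARD('a) ^ i)"
  using p
proof (induction p rule: dec_induct)
  case base
  have "rows_independent m (restrict x {..<m})"
    using x(1) unfolding rows_independent_def by (simp add: lincomb_def)
  then have "basis_extensions x m C m = {restrict x {..<m}}"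
    using x(2) by (force simp: basis_extensions_def fun_eq_iff extensional_def)
  then show ?case by simp
next
  case (step p)
  let ?W = "\<lambda>G. C - vec.span (G ` {..<p})"
  have "basis_extensions x m C (Suc p) = {G(p := w) |G w. G \<in> basis_extensions x m C p \<and> w \<in> ?W G}"
    (is "?L = ?R")
  proof
    show "?L \<subseteq> ?R"
    proof
      fix G assume G: "G \<in> ?L"
      let ?G = "restrict G {..<p}"
      have "?G \<in> basis_extensions x m C p"
        using G step(1) unfolding basis_extensions_def rows_independent_Suc
        by (auto simp: rows_independent_def lincomb_def)
      moreover have "G p \<in> ?W ?G"
        using G unfolding basis_extensions_def rows_independent_Suc by auto
      moreover have "G = ?G(p := G p)"
        using G by (auto simp: basis_extensions_def extensional_def fun_eq_iff)
      ultimately show "G \<in> ?R" by blast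
    qed
    show "?R \<subseteq> ?L"
    proof clarify
      fix G w assume G: "G \<in> basis_extensions x m C p" "w \<in> C" "w \<notin> vec.span (G ` {..<p})"
      have "(G(p := w)) ` {..<p} = G ` {..<p}" by auto
      moreover have "rows_independent p (G(p := w))"
        using G(1) by (simp add: basis_extensions_def rows_independent_def lincomb_def)
      ultimately show "G(p := w) \<in> ?L"
        using G step(1) unfolding basis_extensions_def rows_independent_Suc
        by (auto simp: lessThan_Suc extensional_def)
    qed
  qed
  moreover have "card ?R = card (basis_extensions x m C p) * (CARD('a) ^ k - CARD('a) ^ p)"
  proof (rule card_extension)
    show "basis_extensions x m C p \<subseteq> extensional {..<p}" by (auto simp: basis_extensions_def)
    fix G assume G: "G \<in> basis_extensions x m C p"
    then have "vec.span (G ` {..<p}) \<subseteq> C"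
      using C(1) by (simp add: basis_extensions_def vec.span_minimal)
    then show "card (?W G) = CARD('a) ^ k - CARD('a) ^ p"
      using G C(2) card_span_rows[of p G]
      by (simp add: basis_extensions_def card_Diff_subset)
  qed (simp_all add: finite_basis_extensions)
  ultimately show ?case using step by (simp add: prod.atLeastLessThan_Suc)
qed

lemma span_basis_extension:
  fixes C :: "('a::{field,finite} ^ 'n::finite) set"
  assumes C: "vec.subspace C" "card C = CARD('a) ^ k" and G: "G \<in> basis_extensions x m C k"
  shows "vec.span (G ` {..<k}) = C"
proof (rule card_subset_eq)
  show "vec.span (G ` {..<k}) \<subseteq> C"
    using G C(1) by (simp add: basis_extensions_def vec.span_minimal)
  show "card (vec.span (G ` {..<k})) = card C"
    using G C(2) by (simp add: basis_extensions_def card_span_rows)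
qed simp

lemma card_simplex_code:
  fixes C :: "('a::{field,finite} ^ 'n::finite) set"
  assumes "simplex_code k C"
  shows "card C = CARD('a) ^ k"
proof -
  have "vec.subspace C" "vec.dim C = k" using assms by (auto simp: simplex_code_def)
  from rows_of_subspace[OF this(1)] this(2) obtain x
    where "rows_independent k x" "vec.span (x ` {..<k}) = C" by metis
  then show ?thesis using card_span_rows[of k x] by simp
qed

lemma simplex_code_subspace: "simplex_code k C \<Longrightarrow> vec.subspace C"
  by (simp add: simplex_code_def)

definition simplex_completions ::
    "(nat \<Rightarrow> 'a::field ^ 'n::finite) \<Rightarrow> nat \<Rightarrow> nat \<Rightarrow> (nat \<Rightarrow> 'a ^ 'n) set"
  where "simplex_completions x m k =
    {G \<in> extensional {..<k}. (\<forall>i<m. G i = x i) \<and> simplex_matrix k G}"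

lemma card_simplex_completions_eq_card_codes:
  fixes x :: "nat \<Rightarrow> 'a::{field,finite} ^ 'n::finite"
  assumes x: "rows_independent m x" and n: "CARD('n) = q_number CARD('a) k" and m: "m \<le> k"
  shows "card (simplex_completions x m k) =
    card {C. simplex_code k C \<and> vec.span (x ` {..<m}) \<subseteq> C} *
    (\<Prod>i=m..<k. CARD('a) ^ k - CARD('a) ^ i)"
proof -
  let ?D = "{C. simplex_code k C \<and> vec.span (x ` {..<m}) \<subseteq> C}"
  have "simplex_completions x m k = (\<Union>C\<in>?D. basis_extensions x m C k)"
  proof (intro equalityI subsetI)
    fix G assume G: "G \<in> simplex_completions x m k"
    let ?C = "vec.span (G ` {..<k})"
    have "simplex_matrix k G" using G by (simp add: simplex_completions_def)
    then have "simplex_code k ?C" "rows_independent k G"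
      using n simplex_code_span_rows simplex_matrix_rows_independent by blast+
    moreover have "x ` {..<m} = G ` {..<m}" using G by (simp add: simplex_completions_def)
    then have "x ` {..<m} \<subseteq> G ` {..<k}" using m by auto
    then have "vec.span (x ` {..<m}) \<subseteq> ?C" by (rule vec.span_mono)
    ultimately have "?C \<in> ?D" "G \<in> basis_extensions x m ?C k"
      using G by (auto simp: simplex_completions_def basis_extensions_def vec.span_base)
    then show "G \<in> (\<Union>C\<in>?D. basis_extensions x m C k)" by blast
  next
    fix G assume "G \<in> (\<Union>C\<in>?D. basis_extensions x m C k)"
    then obtain C where C: "simplex_code k C" and G: "G \<in> basis_extensions x m C k" by blast
    have "vec.span (G ` {..<k}) = C"
      using span_basis_extension[OF simplex_code_subspace card_simplex_code] C G by blast
    then have "simplex_matrix k G" using C simplex_matrix_if_spans_simplex_code by blast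
    then show "G \<in> simplex_completions x m k"
      using G by (simp add: simplex_completions_def basis_extensions_def)
  qed
  moreover have "card (\<Union>C\<in>?D. basis_extensions x m C k) =
    (\<Sum>C\<in>?D. card (basis_extensions x m C k))"
  proof (rule card_UN_disjoint)
    show "\<forall>C\<in>?D. \<forall>C'\<in>?D. C \<noteq> C' \<longrightarrow> basis_extensions x m C k \<inter> basis_extensions x m C' k = {}"
    proof (intro ballI impI)
      fix C C' assume C: "C \<in> ?D" "C' \<in> ?D" "C \<noteq> C'"
      then have "vec.subspace C" "vec.subspace C'" "card C = CARD('a) ^ k" "card C' = CARD('a) ^ k"
        by (auto simp: card_simplex_code simplex_code_subspace)
      then show "basis_extensions x m C k \<inter> basis_extensions x m C' k = {}"
        using span_basis_extension[of C k] span_basis_extension[of C' k] \<open>C \<noteq> C'\<close> by blast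
    qed
  qed (simp_all add: finite_basis_extensions)
  moreover have "card (basis_extensions x m C k) = (\<Prod>i=m..<k. CARD('a) ^ k - CARD('a) ^ i)"
    if "C \<in> ?D" for C
  proof (rule card_basis_extensions)
    show "x ` {..<m} \<subseteq> C" using that vec.span_superset[of "x ` {..<m}"] by auto
    show "vec.subspace C" "card C = CARD('a) ^ k"
      using that by (auto simp: card_simplex_code simplex_code_subspace)
  qed (use x m in auto)
  ultimately show ?thesis by simp
qed

lemma simplex_completion_exists:
  fixes x :: "nat \<Rightarrow> 'a::{field,finite} ^ 'n::finite"
  assumes x: "rows_independent m x" and C: "simplex_code k C" "vec.span (x ` {..<m}) \<subseteq> C"
    and m: "m \<le> k"
  obtains G where "G \<in> simplex_completions x m k" "vec.span (G ` {..<k}) = C"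
proof -
  have S: "vec.subspace C" "card C = CARD('a) ^ k"
    using C by (auto simp: card_simplex_code simplex_code_subspace)
  have "x ` {..<m} \<subseteq> C" using C vec.span_superset[of "x ` {..<m}"] by auto
  then have "card (basis_extensions x m C k) = (\<Prod>i=m..<k. CARD('a) ^ k - CARD('a) ^ i)"
    using S x m by (intro card_basis_extensions)
  also have "\<dots> \<noteq> 0"
    using CARD_field_ge_2[where 'a='a]
    by (auto simp: prod_zero_iff not_le intro!: power_strict_increasing)
  finally obtain G where G: "G \<in> basis_extensions x m C k" by (metis all_not_in_conv card.empty)
  have "vec.span (G ` {..<k}) = C" using S G by (rule span_basis_extension)
  moreover from this have "G \<in> simplex_completions x m k"
    using simplex_matrix_if_spans_simplex_code[OF C(1)] G
    by (simp add: simplex_completions_def basis_extensions_def)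
  ultimately show thesis using that by blast
qed

subsection \<open>Completions, column by column\<close>

definition columns_over :: "nat \<Rightarrow> nat \<Rightarrow> (nat \<Rightarrow> 'a::field) \<Rightarrow> (nat \<Rightarrow> 'a) set"
  where "columns_over k m t = {w \<in> {..<k} \<rightarrow>\<^sub>E UNIV. \<forall>i<m. w i = t i}"

definition partial_columns ::
    "(nat \<Rightarrow> 'a::field ^ 'n::finite) \<Rightarrow> nat \<Rightarrow> nat \<Rightarrow> 'n set \<Rightarrow> ('n \<Rightarrow> nat \<Rightarrow> 'a) set"
  where "partial_columns x m k J = {b \<in> (\<Pi>\<^sub>E j\<in>J. columns_over k m (\<lambda>i. x i $ j)).
    (\<forall>j\<in>J. \<exists>i<k. b j i \<noteq> 0) \<and>
    (\<forall>j\<in>J. \<forall>j'\<in>J. j \<noteq> j' \<longrightarrow> \<not> (\<exists>c. \<forall>i<k. b j' i = c * b j i))}"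

definition excluded_columns ::
    "nat \<Rightarrow> nat \<Rightarrow> (nat \<Rightarrow> 'a::field) \<Rightarrow> 'n set \<Rightarrow> ('n \<Rightarrow> nat \<Rightarrow> 'a) \<Rightarrow> (nat \<Rightarrow> 'a) set"
  where "excluded_columns k m t J b = {w \<in> columns_over k m t.
    (\<forall>i<k. w i = 0) \<or> (\<exists>j\<in>J. \<exists>c. \<forall>i<k. w i = c * b j i)}"

lemma finite_columns_over: "finite (columns_over k m (t :: nat \<Rightarrow> 'a::{field,finite}))"
  by (rule finite_subset[of _ "{..<k} \<rightarrow>\<^sub>E UNIV"]) (auto simp: columns_over_def finite_PiE)

lemma card_columns_over:
  fixes t :: "nat \<Rightarrow> 'a::{field,finite}"
  assumes "m \<le> k"
  shows "card (columns_over k m t) = CARD('a) ^ (k - m)"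
proof -
  have "columns_over k m t = (\<Pi>\<^sub>E i\<in>{..<k}. if i < m then {t i} else UNIV)"
  proof (intro equalityI subsetI)
    fix w assume "w \<in> columns_over k m t"
    then show "w \<in> (\<Pi>\<^sub>E i\<in>{..<k}. if i < m then {t i} else UNIV)"
      by (simp add: columns_over_def PiE_iff)
  next
    fix w assume w: "w \<in> (\<Pi>\<^sub>E i\<in>{..<k}. if i < m then {t i} else UNIV)"
    have "w i = t i" if "i < m" for i
      using PiE_mem[OF w, of i] that assms by simp
    then show "w \<in> columns_over k m t"
      using w by (simp add: columns_over_def PiE_iff)
  qed
  then have "card (columns_over k m t) = (\<Prod>i<k. card (if i < m then {t i} else UNIV))"
    by (simp add: card_PiE)
  also have "\<dots> = (\<Prod>i<k. if i < m then 1 else CARD('a))"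
    by (rule prod.cong) auto
  also have "\<dots> = CARD('a) ^ card ({..<k} \<inter> {i. \<not> i < m})"
    by (simp add: prod.If_cases Int_def)
  also have "{..<k} \<inter> {i. \<not> i < m} = {m..<k}" by auto
  finally show ?thesis by simp
qed

lemma partial_columns_scale_inj:
  assumes "b \<in> partial_columns x m k J" "j \<in> J" "j' \<in> J" "c \<noteq> 0" "c' \<noteq> 0"
    and e: "\<And>i. i < k \<Longrightarrow> c * b j i = c' * b j' i"
  shows "j = j' \<and> c = c'"
proof -
  have "b j' i = (c / c') * b j i" if "i < k" for i
    using e[OF that] assms(5) by (simp add: field_simps)
  then have j: "j = j'" using assms(1-3) unfolding partial_columns_def by blast
  obtain i where "i < k" "b j i \<noteq> 0" using assms(1,2) unfolding partial_columns_def by blast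
  then show ?thesis using e[of i] j by simp
qed

lemma partial_columns_top:
  "b \<in> partial_columns x m k J \<Longrightarrow> j \<in> J \<Longrightarrow> i < m \<Longrightarrow> b j i = x i $ j"
  by (auto simp: partial_columns_def columns_over_def PiE_iff)

lemma card_excluded_columns_nonzero:
  fixes x :: "nat \<Rightarrow> 'a::{field,finite} ^ 'n::finite"
  assumes b: "b \<in> partial_columns x m k J" and t: "\<exists>i<m. t i \<noteq> 0" and m: "m \<le> k"
  shows "card (excluded_columns k m t J b) = card {j \<in> J. \<exists>c. \<forall>i<m. t i = c * x i $ j}"
proof -
  let ?K = "{j \<in> J. \<exists>c. \<forall>i<m. t i = c * x i $ j}"
  have "\<forall>j\<in>?K. \<exists>c. \<forall>i<m. t i = c * x i $ j" by simp
  then obtain c where "\<forall>j\<in>?K. \<forall>i<m. t i = c j * x i $ j"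
    by (rule bchoice[THEN exE])
  then have c: "\<And>j i. j \<in> ?K \<Longrightarrow> i < m \<Longrightarrow> t i = c j * x i $ j" by blast
  obtain p where p: "p < m" "t p \<noteq> 0" using t by blast
  have c0: "c j \<noteq> 0" if "j \<in> ?K" for j using c[OF that p(1)] p(2) by auto
  let ?f = "\<lambda>j. \<lambda>i\<in>{..<k}. c j * b j i"
  have "inj_on ?f ?K"
  proof (rule inj_onI)
    fix j j' assume j: "j \<in> ?K" "j' \<in> ?K" and e: "?f j = ?f j'"
    have "c j * b j i = c j' * b j' i" if "i < k" for i
      using fun_cong[OF e, of i] that by simp
    then show "j = j'" using partial_columns_scale_inj[OF b _ _ c0[OF j(1)] c0[OF j(2)]] j by blast
  qed
  moreover have "?f ` ?K = excluded_columns k m t J b"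
  proof (intro equalityI subsetI)
    fix w assume "w \<in> ?f ` ?K"
    then obtain j where j: "j \<in> ?K" "w = ?f j" by blast
    have "w i = t i" if "i < m" for i
      using j c[OF j(1) that] partial_columns_top[OF b _ that] that m by simp
    then show "w \<in> excluded_columns k m t J b"
      using j unfolding excluded_columns_def columns_over_def by auto
  next
    fix w assume w: "w \<in> excluded_columns k m t J b"
    then have top: "\<And>i. i < m \<Longrightarrow> w i = t i" and ext: "w \<in> {..<k} \<rightarrow>\<^sub>E UNIV"
      by (auto simp: excluded_columns_def columns_over_def)
    have "\<not> (\<forall>i<k. w i = 0)" using p top m by (metis order_less_le_trans)
    then obtain j d where j: "j \<in> J" "\<And>i. i < k \<Longrightarrow> w i = d * b j i"
      using w unfolding excluded_columns_def by blast
    have d: "t i = d * x i $ j" if "i < m" for i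
      using that m j top partial_columns_top[OF b j(1) that] by (metis order_less_le_trans)
    then have jK: "j \<in> ?K" using j(1) by blast
    have "c j = d" using c[OF jK p(1)] d[OF p(1)] p(2) by auto
    then have "w = ?f j" using j(2) ext by (auto simp: fun_eq_iff PiE_iff extensional_def)
    then show "w \<in> ?f ` ?K" using jK by blast
  qed
  ultimately have "bij_betw ?f ?K (excluded_columns k m t J b)" by (rule bij_betw_imageI)
  then show ?thesis by (rule bij_betw_same_card[symmetric])
qed

lemma card_excluded_columns_zero:
  fixes x :: "nat \<Rightarrow> 'a::{field,finite} ^ 'n::finite"
  assumes b: "b \<in> partial_columns x m k J" and t: "\<And>i. i < m \<Longrightarrow> t i = 0" and m: "m \<le> k"
  shows "card (excluded_columns k m t J b) =
    1 + card {j \<in> J. \<forall>i<m. x i $ j = 0} * (CARD('a) - 1)"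
proof -
  let ?K = "{j \<in> J. \<forall>i<m. x i $ j = 0}"
  let ?D = "?K \<times> (UNIV - {0::'a})"
  let ?f = "\<lambda>(j, c). \<lambda>i\<in>{..<k}. c * b j i"
  let ?z = "\<lambda>i\<in>{..<k}. 0 :: 'a"
  have "inj_on ?f ?D"
  proof (rule inj_onI)
    fix y y' assume "y \<in> ?D" "y' \<in> ?D" and e: "?f y = ?f y'"
    then obtain j c j' c' where y: "y = (j, c)" "y' = (j', c')" "c \<noteq> 0" "c' \<noteq> 0" "j \<in> J" "j' \<in> J"
      by auto
    have "c * b j i = c' * b j' i" if "i < k" for i
      using fun_cong[OF e, of i] that y by simp
    then show "y = y'" using partial_columns_scale_inj[OF b] y by blast
  qed
  then have "card (?f ` ?D) = card ?K * (CARD('a) - 1)"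
    by (simp add: card_image card_cartesian_product card_Diff_singleton)
  moreover have "?z \<notin> ?f ` ?D"
  proof
    assume "?z \<in> ?f ` ?D"
    then obtain j c where y: "c \<noteq> 0" "j \<in> J" and e: "?z = (\<lambda>i\<in>{..<k}. c * b j i)" by auto
    obtain i where "i < k" "b j i \<noteq> 0" using b y(2) unfolding partial_columns_def by blast
    then show False using fun_cong[OF e, of i] y by simp
  qed
  moreover have "excluded_columns k m t J b = insert ?z (?f ` ?D)"
  proof (intro equalityI subsetI)
    fix w assume w: "w \<in> excluded_columns k m t J b"
    then have top: "\<And>i. i < m \<Longrightarrow> w i = 0" and ext: "w \<in> extensional {..<k}"
      using t by (auto simp: excluded_columns_def columns_over_def PiE_def)
    show "w \<in> insert ?z (?f ` ?D)"
    proof (cases "\<forall>i<k. w i = 0")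
      case True
      then have "w = ?z" using ext by (auto simp: fun_eq_iff extensional_def)
      then show ?thesis by blast
    next
      case False
      then obtain j d where j: "j \<in> J" "\<And>i. i < k \<Longrightarrow> w i = d * b j i"
        using w unfolding excluded_columns_def by blast
      have d: "d \<noteq> 0" using False j by auto
      have "x i $ j = 0" if "i < m" for i
        using top[OF that] j(2)[of i] that m d partial_columns_top[OF b j(1) that] by simp
      then have "(j, d) \<in> ?D" using j d by blast
      moreover have "w = ?f (j, d)" using j(2) ext by (auto simp: fun_eq_iff extensional_def)
      ultimately show ?thesis by blast
    qed
  next
    fix w assume "w \<in> insert ?z (?f ` ?D)"
    then consider "w = ?z" | j d where "j \<in> ?K" "d \<noteq> 0" "w = ?f (j, d)" by auto
    then show "w \<in> excluded_columns k m t J b"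
    proof cases
      case 1
      then show ?thesis using t m by (auto simp: excluded_columns_def columns_over_def)
    next
      case 2
      then have "w i = t i" if "i < m" for i
        using that t m partial_columns_top[OF b _ that, of j] by simp
      then show ?thesis using 2 by (auto simp: excluded_columns_def columns_over_def)
    qed
  qed
  moreover have "finite (?f ` ?D)" by simp
  ultimately show ?thesis by simp
qed

lemma partial_columns_insert:
  fixes x :: "nat \<Rightarrow> 'a::field ^ 'n::finite"
  assumes j: "j \<notin> J"
  shows "partial_columns x m k (insert j J) = {b(j := w) |b w. b \<in> partial_columns x m k J \<and>
    w \<in> columns_over k m (\<lambda>i. x i $ j) - excluded_columns k m (\<lambda>i. x i $ j) J b}"
    (is "?L = ?R")
proof (intro equalityI subsetI)
  fix b assume b: "b \<in> ?L"
  have "restrict b J \<in> partial_columns x m k J" "b = (restrict b J)(j := b j)"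
    using b j by (auto simp: partial_columns_def PiE_iff extensional_def fun_eq_iff)
  moreover have "b j \<in> columns_over k m (\<lambda>i. x i $ j)"
    using b by (auto simp: partial_columns_def PiE_iff)
  moreover have "b j \<notin> excluded_columns k m (\<lambda>i. x i $ j) J (restrict b J)"
  proof
    assume "b j \<in> excluded_columns k m (\<lambda>i. x i $ j) J (restrict b J)"
    moreover have "\<not> (\<forall>i<k. b j i = 0)" using b unfolding partial_columns_def by blast
    ultimately obtain j' c where "j' \<in> J" "\<forall>i<k. b j i = c * b j' i"
      unfolding excluded_columns_def by auto
    moreover from this have "j' \<noteq> j" using j by blast
    ultimately show False using b unfolding partial_columns_def by blast
  qed
  ultimately show "b \<in> ?R" by blast
next
  fix b' assume "b' \<in> ?R"
  then obtain b w where b': "b' = b(j := w)" and b: "b \<in> partial_columns x m k J"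
    and w: "w \<in> columns_over k m (\<lambda>i. x i $ j)" "w \<notin> excluded_columns k m (\<lambda>i. x i $ j) J b"
    by blast
  have w0: "\<exists>i<k. w i \<noteq> 0" and wb: "\<And>j' c. j' \<in> J \<Longrightarrow> \<not> (\<forall>i<k. w i = c * b j' i)"
    using w unfolding excluded_columns_def by blast+
  have bw: "\<not> (\<forall>i<k. b j' i = c * w i)" if j': "j' \<in> J" for j' c
  proof
    assume e: "\<forall>i<k. b j' i = c * w i"
    obtain i where "i < k" "b j' i \<noteq> 0" using b j' unfolding partial_columns_def by blast
    then have "c \<noteq> 0" using e by auto
    then have "\<forall>i<k. w i = inverse c * b j' i" using e by (simp add: field_simps)
    then show False using wb j' by blast
  qed
  have "b' \<in> (\<Pi>\<^sub>E j\<in>insert j J. columns_over k m (\<lambda>i. x i $ j))"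
    using b w(1) j by (auto simp: b' partial_columns_def PiE_iff extensional_def)
  moreover have "\<forall>j'\<in>insert j J. \<exists>i<k. b' j' i \<noteq> 0"
    using b w0 by (auto simp: b' partial_columns_def)
  moreover have "\<forall>j1\<in>insert j J. \<forall>j2\<in>insert j J. j1 \<noteq> j2 \<longrightarrow>
      \<not> (\<exists>c. \<forall>i<k. b' j2 i = c * b' j1 i)"
  proof (intro ballI impI)
    fix j1 j2 assume J: "j1 \<in> insert j J" "j2 \<in> insert j J" "j1 \<noteq> j2"
    then consider "j1 = j" "j2 \<in> J" "j2 \<noteq> j" | "j2 = j" "j1 \<in> J" "j1 \<noteq> j"
      | "j1 \<in> J" "j2 \<in> J" "j1 \<noteq> j" "j2 \<noteq> j" by blast
    then show "\<not> (\<exists>c. \<forall>i<k. b' j2 i = c * b' j1 i)"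
    proof cases
      case 1
      then show ?thesis using bw by (simp add: b')
    next
      case 2
      then show ?thesis using wb by (simp add: b')
    next
      case 3
      then show ?thesis using b J(3) by (simp add: b' partial_columns_def)
    qed
  qed
  ultimately show "b' \<in> ?L" unfolding partial_columns_def by blast
qed

definition zero_tops :: "(nat \<Rightarrow> 'a::field ^ 'n::finite) \<Rightarrow> nat \<Rightarrow> 'n set"
  where "zero_tops x m = {j. \<forall>i<m. x i $ j = 0}"

definition top_class :: "(nat \<Rightarrow> 'a::field ^ 'n::finite) \<Rightarrow> nat \<Rightarrow> 'n \<Rightarrow> 'n set"
  where "top_class x m j = {j'. \<exists>c. c \<noteq> 0 \<and> (\<forall>i<m. x i $ j = c * x i $ j')}"

lemma top_class_self: "j \<in> top_class x m j"
  unfolding top_class_def by (rule CollectI, rule exI[of _ 1]) simp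

lemma top_class_sym: "j' \<in> top_class x m j \<Longrightarrow> j \<in> top_class x m j'"
proof -
  assume "j' \<in> top_class x m j"
  then obtain c where "c \<noteq> 0" "\<forall>i<m. x i $ j = c * x i $ j'" unfolding top_class_def by blast
  then have "inverse c \<noteq> 0 \<and> (\<forall>i<m. x i $ j' = inverse c * x i $ j)" by simp
  then show ?thesis unfolding top_class_def by blast
qed

lemma top_class_trans:
  assumes "j' \<in> top_class x m j" "j'' \<in> top_class x m j'"
  shows "j'' \<in> top_class x m j"
proof -
  obtain c d where "c \<noteq> 0" "\<forall>i<m. x i $ j = c * x i $ j'" "d \<noteq> 0" "\<forall>i<m. x i $ j' = d * x i $ j''"
    using assms unfolding top_class_def by blast
  then have "c * d \<noteq> 0 \<and> (\<forall>i<m. x i $ j = (c * d) * x i $ j'')" by simp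
  then show ?thesis unfolding top_class_def by blast
qed

lemma top_class_eq: "j' \<in> top_class x m j \<Longrightarrow> top_class x m j' = top_class x m j"
  using top_class_sym top_class_trans by blast

lemma top_class_disjoint:
  "\<kappa> \<in> range (top_class x m) \<Longrightarrow> \<kappa>' \<in> range (top_class x m) \<Longrightarrow> \<kappa> \<noteq> \<kappa>' \<Longrightarrow> \<kappa> \<inter> \<kappa>' = {}"
  using top_class_eq by blast

lemma top_class_zero: "j \<in> zero_tops x m \<Longrightarrow> top_class x m j = zero_tops x m"
  unfolding top_class_def zero_tops_def by (auto intro: exI[of _ 1])

lemma top_class_zero_iff: "top_class x m j = zero_tops x m \<longleftrightarrow> j \<in> zero_tops x m"
  using top_class_zero top_class_self by blast

lemma top_class_nonzero:
  assumes "j \<notin> zero_tops x m"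
  shows "top_class x m j = {j'. \<exists>c. \<forall>i<m. x i $ j = c * x i $ j'}"
proof -
  have "c \<noteq> 0" if "\<forall>i<m. x i $ j = c * x i $ j'" for c j'
    using that assms by (auto simp: zero_tops_def)
  then show ?thesis unfolding top_class_def by blast
qed

text \<open>The number of admissible columns lying over a given top once \<open>i\<close> columns with a
  proportional top have been placed.\<close>

definition free_columns :: "(nat \<Rightarrow> 'a::{field,finite} ^ 'n::finite) \<Rightarrow> nat \<Rightarrow> nat \<Rightarrow> 'n set \<Rightarrow> nat \<Rightarrow> nat"
  where "free_columns x m k \<kappa> i =
    CARD('a) ^ (k - m) - (if \<kappa> = zero_tops x m then 1 + i * (CARD('a) - 1) else i)"

lemma card_free_columns:
  fixes x :: "nat \<Rightarrow> 'a::{field,finite} ^ 'n::finite"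
  assumes b: "b \<in> partial_columns x m k J" and m: "m \<le> k"
  shows "card (columns_over k m (\<lambda>i. x i $ j) - excluded_columns k m (\<lambda>i. x i $ j) J b) =
    free_columns x m k (top_class x m j) (card (J \<inter> top_class x m j))"
proof -
  have sub: "excluded_columns k m (\<lambda>i. x i $ j) J b \<subseteq> columns_over k m (\<lambda>i. x i $ j)"
    by (auto simp: excluded_columns_def)
  then have "finite (excluded_columns k m (\<lambda>i. x i $ j) J b)"
    using finite_columns_over by (rule finite_subset)
  then have "card (columns_over k m (\<lambda>i. x i $ j) - excluded_columns k m (\<lambda>i. x i $ j) J b) =
      CARD('a) ^ (k - m) - card (excluded_columns k m (\<lambda>i. x i $ j) J b)"
    using sub m by (simp add: card_Diff_subset card_columns_over)
  moreover have "card (excluded_columns k m (\<lambda>i. x i $ j) J b) =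
    (if top_class x m j = zero_tops x m then 1 + card (J \<inter> top_class x m j) * (CARD('a) - 1)
     else card (J \<inter> top_class x m j))"
  proof (cases "j \<in> zero_tops x m")
    case True
    then have "card (excluded_columns k m (\<lambda>i. x i $ j) J b) =
        1 + card {j \<in> J. \<forall>i<m. x i $ j = 0} * (CARD('a) - 1)"
      using b m by (intro card_excluded_columns_zero) (auto simp: zero_tops_def)
    moreover have "{j \<in> J. \<forall>i<m. x i $ j = 0} = J \<inter> zero_tops x m"
      by (auto simp: zero_tops_def)
    ultimately show ?thesis using top_class_zero[OF True] by simp
  next
    case False
    then have "card (excluded_columns k m (\<lambda>i. x i $ j) J b) =
        card {j' \<in> J. \<exists>c. \<forall>i<m. x i $ j = c * x i $ j'}"
      using b m by (intro card_excluded_columns_nonzero) (auto simp: zero_tops_def)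
    moreover have "{j' \<in> J. \<exists>c. \<forall>i<m. x i $ j = c * x i $ j'} = J \<inter> top_class x m j"
      using top_class_nonzero[OF False] by auto
    ultimately show ?thesis using False by (simp add: top_class_zero_iff)
  qed
  ultimately show ?thesis by (simp add: free_columns_def)
qed

lemma card_partial_columns:
  fixes x :: "nat \<Rightarrow> 'a::{field,finite} ^ 'n::finite"
  assumes m: "m \<le> k"
  shows "card (partial_columns x m k J) =
    (\<Prod>\<kappa>\<in>range (top_class x m). \<Prod>i<card (J \<inter> \<kappa>). free_columns x m k \<kappa> i)"
proof (induction J rule: finite_induct[OF finite])
  case 1
  have "partial_columns x m k {} = {\<lambda>_. undefined}" by (auto simp: partial_columns_def)
  then show ?case by simp
next
  case (2 j J)
  let ?h = "free_columns x m k (top_class x m j) (card (J \<inter> top_class x m j))"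
  have fin: "finite (partial_columns x m k J)"
    by (rule finite_subset[of _ "\<Pi>\<^sub>E j\<in>J. columns_over k m (\<lambda>i. x i $ j)"])
      (auto simp: partial_columns_def finite_PiE finite_columns_over)
  have "card (partial_columns x m k (insert j J)) = card (partial_columns x m k J) * ?h"
    unfolding partial_columns_insert[OF 2(2)]
  proof (rule card_extension[OF _ 2(2) fin])
    show "partial_columns x m k J \<subseteq> extensional J"
      by (auto simp: partial_columns_def PiE_def)
  qed (simp_all add: m card_free_columns finite_columns_over)
  also have "\<dots> = (\<Prod>\<kappa>\<in>range (top_class x m). (\<Prod>i<card (J \<inter> \<kappa>). free_columns x m k \<kappa> i)) *
      (\<Prod>\<kappa>\<in>range (top_class x m). if \<kappa> = top_class x m j then ?h else 1)"
    by (simp add: 2)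
  also have "\<dots> = (\<Prod>\<kappa>\<in>range (top_class x m). \<Prod>i<card (insert j J \<inter> \<kappa>). free_columns x m k \<kappa> i)"
    unfolding prod.distrib[symmetric]
  proof (rule prod.cong[OF refl])
    fix \<kappa> assume \<kappa>: "\<kappa> \<in> range (top_class x m)"
    show "(\<Prod>i<card (J \<inter> \<kappa>). free_columns x m k \<kappa> i) * (if \<kappa> = top_class x m j then ?h else 1) =
      (\<Prod>i<card (insert j J \<inter> \<kappa>). free_columns x m k \<kappa> i)"
    proof (cases "\<kappa> = top_class x m j")
      case True
      then have "insert j J \<inter> \<kappa> = insert j (J \<inter> \<kappa>)" using top_class_self by blast
      then show ?thesis using True 2(2) by simp
    next
      case False
      then have "j \<notin> \<kappa>" using \<kappa> top_class_eq by blast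
      then show ?thesis using False by simp
    qed
  qed
  finally show ?case .
qed

lemma partial_columns_bij_simplex_completions:
  fixes x :: "nat \<Rightarrow> 'a::{field,finite} ^ 'n::finite"
  assumes m: "m \<le> k"
  shows "bij_betw (\<lambda>G j. \<lambda>i\<in>{..<k}. G i $ j) (simplex_completions x m k) (partial_columns x m k UNIV)"
proof (rule bij_betw_byWitness[where f' = "\<lambda>b. \<lambda>i\<in>{..<k}. \<chi> j. b j i"])
  show "\<forall>G\<in>simplex_completions x m k. (\<lambda>i\<in>{..<k}. \<chi> j. (\<lambda>i\<in>{..<k}. G i $ j) i) = G"
    by (auto simp: simplex_completions_def fun_eq_iff vec_eq_iff extensional_def)
  show "\<forall>b\<in>partial_columns x m k UNIV. (\<lambda>j. \<lambda>i\<in>{..<k}. (\<lambda>i\<in>{..<k}. \<chi> j. b j i) i $ j) = b"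
    by (auto simp: partial_columns_def columns_over_def fun_eq_iff PiE_iff extensional_def)
  show "(\<lambda>G j. \<lambda>i\<in>{..<k}. G i $ j) ` simplex_completions x m k \<subseteq> partial_columns x m k UNIV"
  proof (rule image_subsetI)
    fix G assume "G \<in> simplex_completions x m k"
    then have G: "\<forall>i<m. G i = x i" "\<forall>j. \<exists>i<k. G i $ j \<noteq> 0"
      "\<forall>j j'. j \<noteq> j' \<longrightarrow> \<not> (\<exists>c. \<forall>i<k. G i $ j' = c * G i $ j)"
      by (auto simp: simplex_completions_def simplex_matrix_def nonzero_column_def
          proportional_columns_def)
    have "(\<lambda>i\<in>{..<k}. G i $ j) \<in> columns_over k m (\<lambda>i. x i $ j)" for j
      using G(1) m by (simp add: columns_over_def)
    moreover have "(\<lambda>i\<in>{..<k}. G i $ j) i = G i $ j" if "i < k" for i j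
      using that by simp
    ultimately show "(\<lambda>j. \<lambda>i\<in>{..<k}. G i $ j) \<in> partial_columns x m k UNIV"
      using G(2,3) by (simp add: partial_columns_def PiE_iff cong: conj_cong imp_cong)
  qed
  show "(\<lambda>b. \<lambda>i\<in>{..<k}. \<chi> j. b j i) ` partial_columns x m k UNIV \<subseteq> simplex_completions x m k"
  proof (rule image_subsetI)
    fix b assume b: "b \<in> partial_columns x m k UNIV"
    let ?G = "\<lambda>i\<in>{..<k}. \<chi> j. b j i"
    have "?G i = x i" if "i < m" for i
      using that m partial_columns_top[OF b _ that] by (simp add: vec_eq_iff)
    moreover have "?G i $ j = b j i" if "i < k" for i j using that by simp
    ultimately show "?G \<in> simplex_completions x m k"
      using b by (simp add: simplex_completions_def partial_columns_def simplex_matrix_def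
          nonzero_column_def proportional_columns_def cong: conj_cong imp_cong)
  qed
qed

lemma excluded_columns_simplex_matrix:
  fixes x :: "nat \<Rightarrow> 'a::{field,finite} ^ 'n::finite"
  assumes G: "G \<in> simplex_completions x m k" and n: "CARD('n) = q_number CARD('a) k"
  shows "excluded_columns k m t UNIV (\<lambda>j. \<lambda>i\<in>{..<k}. G i $ j) = columns_over k m t"
proof -
  have "\<exists>j c. \<forall>i<k. w i = c * G i $ j" if "\<exists>i<k. w i \<noteq> 0" for w
  proof -
    have "simplex_matrix k G" using G by (simp add: simplex_completions_def)
    from simplex_matrix_columns_cover[OF this n that] show ?thesis by metis
  qed
  then show ?thesis by (fastforce simp: excluded_columns_def)
qed

lemma card_top_classes:
  fixes x :: "nat \<Rightarrow> 'a::{field,finite} ^ 'n::finite"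
  assumes G: "G \<in> simplex_completions x m k" and n: "CARD('n) = q_number CARD('a) k" and m: "m \<le> k"
  shows "card (zero_tops x m) = q_number CARD('a) (k - m)"
    and "j \<notin> zero_tops x m \<Longrightarrow> card (top_class x m j) = CARD('a) ^ (k - m)"
proof -
  let ?b = "\<lambda>j. \<lambda>i\<in>{..<k}. G i $ j"
  have b: "?b \<in> partial_columns x m k UNIV"
    using partial_columns_bij_simplex_completions[OF m] G by (rule bij_betwE[THEN bspec])
  have "CARD('a) ^ (k - m) = 1 + card {j \<in> UNIV. \<forall>i<m. x i $ j = 0} * (CARD('a) - 1)"
    using card_excluded_columns_zero[OF b _ m, of "\<lambda>_. 0"] m
    unfolding excluded_columns_simplex_matrix[OF G n] by (simp add: card_columns_over)
  then have "card (zero_tops x m) * (CARD('a) - 1) = q_number CARD('a) (k - m) * (CARD('a) - 1)"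
    unfolding q_number_mult[OF CARD_field_ge_2] by (simp add: zero_tops_def)
  then show "card (zero_tops x m) = q_number CARD('a) (k - m)"
    using CARD_field_ge_2[where 'a='a] by simp
  assume j: "j \<notin> zero_tops x m"
  then show "card (top_class x m j) = CARD('a) ^ (k - m)"
    using card_excluded_columns_nonzero[OF b _ m, of "\<lambda>i. x i $ j"] m
    unfolding excluded_columns_simplex_matrix[OF G n]
    by (simp add: card_columns_over top_class_nonzero zero_tops_def)
qed

lemma q_number_add:
  assumes "q \<ge> 2"
  shows "q_number q (m + r) = q_number q r + q_number q m * q ^ r"
proof -
  have "(q_number q r + q_number q m * q ^ r) * (q - 1) =
      q_number q r * (q - 1) + q_number q m * (q - 1) * q ^ r"
    by (simp only: add_mult_distrib2 mult.assoc mult.commute[of _ "q - 1"] mult.left_commute[of _ "q - 1"])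
  also have "\<dots> = (q ^ r - 1) + (q ^ m - 1) * q ^ r"
    by (simp only: q_number_mult[OF assms])
  also have "\<dots> = q ^ (m + r) - 1"
  proof -
    have "q ^ r \<ge> 1" "q ^ r \<le> q ^ m * q ^ r" using assms by simp_all
    then show ?thesis by (simp add: power_add diff_mult_distrib)
  qed
  finally have "(q_number q r + q_number q m * q ^ r) * (q - 1) = q_number q (m + r) * (q - 1)"
    by (simp only: q_number_mult[OF assms])
  then show ?thesis using assms by simp
qed

lemma card_nonzero_top_classes:
  fixes x :: "nat \<Rightarrow> 'a::{field,finite} ^ 'n::finite"
  assumes G: "G \<in> simplex_completions x m k" and n: "CARD('n) = q_number CARD('a) k" and m: "m \<le> k"
  shows "card (range (top_class x m) - {zero_tops x m}) = q_number CARD('a) m"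
proof -
  let ?R = "range (top_class x m) - {zero_tops x m}"
  have c: "card \<kappa> = CARD('a) ^ (k - m)" if "\<kappa> \<in> ?R" for \<kappa>
  proof -
    obtain j where "\<kappa> = top_class x m j" "j \<notin> zero_tops x m"
      using \<open>\<kappa> \<in> ?R\<close> top_class_zero by blast
    then show ?thesis using card_top_classes(2)[OF G n m] by simp
  qed
  have "UNIV = zero_tops x m \<union> \<Union>?R"
    using top_class_self[of _ x m] by blast
  moreover have "zero_tops x m \<inter> \<Union>?R = {}"
    using top_class_zero[of _ x m] top_class_eq[of _ x m] by blast
  ultimately have "CARD('n) = card (zero_tops x m) + card (\<Union>?R)"
    by (metis card_Un_disjoint finite)
  also have "card (\<Union>?R) = (\<Sum>\<kappa>\<in>?R. card \<kappa>)"
    using top_class_disjoint[of _ x m] by (intro card_Union_disjoint) (auto simp: pairwise_def disjnt_def)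
  also have "\<dots> = card ?R * CARD('a) ^ (k - m)" using c by simp
  finally have "q_number CARD('a) (m + (k - m)) =
      q_number CARD('a) (k - m) + card ?R * CARD('a) ^ (k - m)"
    using card_top_classes(1)[OF G n m] n m by simp
  then show ?thesis
    using CARD_field_ge_2[where 'a='a] by (simp add: q_number_add)
qed

lemma card_simplex_completions:
  fixes x :: "nat \<Rightarrow> 'a::{field,finite} ^ 'n::finite"
  assumes G: "G \<in> simplex_completions x m k" and n: "CARD('n) = q_number CARD('a) k" and m: "m < k"
    and q: "q = CARD('a)" and N: "N = q_number q (k - m)"
  shows "card (simplex_completions x m k) =
    fact N * (q - 1) ^ N * fact (q ^ (k - m)) ^ q_number q m"
proof -
  let ?R = "range (top_class x m)" and ?Z = "zero_tops x m"
  have q2: "q \<ge> 2" using q CARD_field_ge_2 by simp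
  have mk: "m \<le> k" using m by simp
  have desc: "(\<Prod>i<d. d - i) = (fact d :: nat)" for d
    by (simp add: fact_prod_rev atLeast0LessThan)
  have "q ^ (k - m) > 1" using q2 m by (intro one_less_power) auto
  then have "q ^ (k - m) - 1 > 0" by simp
  then have "N * (q - 1) > 0" using q_number_mult[OF q2] N by simp
  then have "?Z \<noteq> {}" using card_top_classes(1)[OF G n mk] N q by auto
  then have Z: "?Z \<in> ?R" using top_class_zero by (metis ex_in_conv rangeI)
  have "card (simplex_completions x m k) = card (partial_columns x m k UNIV)"
    by (rule bij_betw_same_card[OF partial_columns_bij_simplex_completions[OF mk]])
  also have "\<dots> = (\<Prod>\<kappa>\<in>?R. \<Prod>i<card \<kappa>. free_columns x m k \<kappa> i)"
    by (simp add: card_partial_columns[OF mk])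
  also have "\<dots> = (\<Prod>i<card ?Z. free_columns x m k ?Z i) *
      (\<Prod>\<kappa>\<in>?R - {?Z}. \<Prod>i<card \<kappa>. free_columns x m k \<kappa> i)"
    by (rule prod.remove[OF finite Z])
  also have "(\<Prod>i<card ?Z. free_columns x m k ?Z i) = (\<Prod>i<N. (N - i) * (q - 1))"
  proof (rule prod.cong)
    show "{..<card ?Z} = {..<N}" using card_top_classes(1)[OF G n mk] N q by simp
    fix i
    have "free_columns x m k ?Z i = (q ^ (k - m) - 1) - i * (q - 1)"
      by (simp add: free_columns_def q)
    also have "\<dots> = (N - i) * (q - 1)"
      using q_number_mult[OF q2, of "k - m"] N by (simp add: diff_mult_distrib)
    finally show "free_columns x m k ?Z i = (N - i) * (q - 1)" .
  qed
  also have "\<dots> = fact N * (q - 1) ^ N" by (simp add: prod.distrib desc)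
  also have "(\<Prod>\<kappa>\<in>?R - {?Z}. \<Prod>i<card \<kappa>. free_columns x m k \<kappa> i) =
      (\<Prod>\<kappa>\<in>?R - {?Z}. fact (q ^ (k - m)))"
  proof (rule prod.cong[OF refl])
    fix \<kappa> assume \<kappa>: "\<kappa> \<in> ?R - {?Z}"
    then obtain j where "\<kappa> = top_class x m j" "j \<notin> ?Z" using top_class_zero by blast
    then have "card \<kappa> = q ^ (k - m)" using card_top_classes(2)[OF G n mk] q by simp
    then show "(\<Prod>i<card \<kappa>. free_columns x m k \<kappa> i) = fact (q ^ (k - m))"
      using \<kappa> by (simp add: free_columns_def q desc)
  qed
  also have "\<dots> = fact (q ^ (k - m)) ^ q_number q m"
    using card_nonzero_top_classes[OF G n mk] q by simp
  finally show ?thesis .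
qed

subsection \<open>Codes with prescribed intersection\<close>

lemma lincomb_truncate:
  assumes "m \<le> k" and "\<And>i. m \<le> i \<Longrightarrow> i < k \<Longrightarrow> l i = 0"
  shows "lincomb k l G = lincomb m l G"
  unfolding lincomb_def
  by (rule sum.mono_neutral_right) (use assms in \<open>auto simp: not_less\<close>)

definition supported_vectors :: "nat \<Rightarrow> (nat \<Rightarrow> 'a::zero) set"
  where "supported_vectors k = {w. \<forall>i\<ge>k. w i = 0}"

text \<open>Applying such a map to the columns of a simplex matrix whose first \<open>m\<close> rows span \<open>X\<close>
  gives a simplex code whose intersection with the original one is \<open>X\<close>.\<close>

definition column_twist :: "nat \<Rightarrow> nat \<Rightarrow> ((nat \<Rightarrow> 'a::field) \<Rightarrow> nat \<Rightarrow> 'a) \<Rightarrow> bool"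
  where "column_twist k m \<sigma> \<longleftrightarrow>
    (\<forall>c w i. c \<noteq> 0 \<longrightarrow> i < k \<longrightarrow> \<sigma> (\<lambda>i. c * w i) i = c * \<sigma> w i) \<and>
    (\<forall>i<k. \<sigma> (\<lambda>_. 0) i = 0) \<and>
    (\<forall>w\<in>supported_vectors k. \<forall>w'\<in>supported_vectors k. (\<forall>i<k. \<sigma> w i = \<sigma> w' i) \<longrightarrow> w = w') \<and>
    (\<forall>w. \<forall>i<m. \<sigma> w i = w i) \<and>
    (\<forall>l l'. (\<forall>w\<in>supported_vectors k. (\<Sum>i<k. l i * w i) = (\<Sum>i<k. l' i * \<sigma> w i)) \<longrightarrow>
      (\<forall>i. m \<le> i \<longrightarrow> i < k \<longrightarrow> l i = 0))"

lemma column_twistI: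
  assumes "\<And>c w i. c \<noteq> 0 \<Longrightarrow> i < k \<Longrightarrow> \<sigma> (\<lambda>i. c * w i) i = c * \<sigma> w i"
    and "\<And>i. i < k \<Longrightarrow> \<sigma> (\<lambda>_. 0) i = 0"
    and "\<And>w w'. w \<in> supported_vectors k \<Longrightarrow> w' \<in> supported_vectors k \<Longrightarrow>
      \<forall>i<k. \<sigma> w i = \<sigma> w' i \<Longrightarrow> w = w'"
    and "\<And>w i. i < m \<Longrightarrow> \<sigma> w i = w i"
    and "\<And>l l' i. \<forall>w\<in>supported_vectors k. (\<Sum>i<k. l i * w i) = (\<Sum>i<k. l' i * \<sigma> w i) \<Longrightarrow>
      m \<le> i \<Longrightarrow> i < k \<Longrightarrow> l i = 0"
  shows "column_twist k m \<sigma>"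
  unfolding column_twist_def by (intro conjI allI ballI impI) (rule assms; assumption)+

lemma column_twist_codes:
  fixes G :: "nat \<Rightarrow> 'a::{field,finite} ^ 'n::finite"
  assumes \<sigma>: "column_twist k m (\<sigma> :: (nat \<Rightarrow> 'a) \<Rightarrow> nat \<Rightarrow> 'a)" and G: "simplex_matrix k G"
    and n: "CARD('n) = q_number CARD('a) k" and m: "m \<le> k"
  shows "\<exists>G'. simplex_matrix k G' \<and>
    vec.span (G ` {..<k}) \<inter> vec.span (G' ` {..<k}) = vec.span (G ` {..<m})"
proof -
  have hom: "\<And>c w i. c \<noteq> 0 \<Longrightarrow> i < k \<Longrightarrow> \<sigma> (\<lambda>i. c * w i) i = c * \<sigma> w i"
    and zero: "\<And>i. i < k \<Longrightarrow> \<sigma> (\<lambda>_. 0) i = 0"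
    and inj: "\<And>w w'. w \<in> supported_vectors k \<Longrightarrow> w' \<in> supported_vectors k \<Longrightarrow>
      (\<And>i. i < k \<Longrightarrow> \<sigma> w i = \<sigma> w' i) \<Longrightarrow> w = w'"
    and top: "\<And>w i. i < m \<Longrightarrow> \<sigma> w i = w i"
    and sep: "\<And>l l' i. (\<And>w. w \<in> supported_vectors k \<Longrightarrow>
      (\<Sum>i<k. l i * w i) = (\<Sum>i<k. l' i * \<sigma> w i)) \<Longrightarrow> m \<le> i \<Longrightarrow> i < k \<Longrightarrow> l i = 0"
    using \<sigma> unfolding column_twist_def by blast+
  define v where "v j i = (if i < k then G i $ j else 0)" for j i
  define G' where "G' i = (\<chi> j. \<sigma> (v j) i)" for i
  have v: "v j \<in> supported_vectors k" "(\<lambda>i. c * v j i) \<in> supported_vectors k" for j c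
    by (simp_all add: v_def supported_vectors_def)
  have v0: "(\<lambda>_. 0) \<in> supported_vectors k" by (simp add: supported_vectors_def)
  have G'nz: "\<exists>i<k. G' i $ j \<noteq> 0" for j
  proof (rule ccontr)
    assume "\<not> (\<exists>i<k. G' i $ j \<noteq> 0)"
    then have "v j = (\<lambda>_. 0)" by (intro inj v v0) (simp add: G'_def zero)
    moreover obtain i where "i < k" "G i $ j \<noteq> 0"
      using G unfolding simplex_matrix_def nonzero_column_def by blast
    ultimately show False by (auto simp: v_def fun_eq_iff split: if_splits)
  qed
  have "simplex_matrix k G'"
    unfolding simplex_matrix_def
  proof (intro conjI allI impI)
    show "nonzero_column k G' j" for j using G'nz by (simp add: nonzero_column_def)
    fix j j' :: 'n assume j: "j \<noteq> j'"
    show "\<not> proportional_columns k G' j j'"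
    proof
      assume "proportional_columns k G' j j'"
      then obtain c where c: "\<And>i. i < k \<Longrightarrow> G' i $ j' = c * G' i $ j"
        unfolding proportional_columns_def by blast
      have "c \<noteq> 0" using G'nz[of j'] c by auto
      then have "v j' = (\<lambda>i. c * v j i)"
        using c by (intro inj v) (simp add: hom G'_def)
      then have "G i $ j' = c * G i $ j" if "i < k" for i
        using that by (auto simp: v_def fun_eq_iff split: if_splits)
      then have "proportional_columns k G j j'" unfolding proportional_columns_def by blast
      then show False using G j unfolding simplex_matrix_def by blast
    qed
  qed
  moreover have "vec.span (G ` {..<k}) \<inter> vec.span (G' ` {..<k}) = vec.span (G ` {..<m})"
  proof (intro equalityI subsetI)
    fix z assume "z \<in> vec.span (G ` {..<k}) \<inter> vec.span (G' ` {..<k})"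
    then have "z \<in> range (\<lambda>l. lincomb k l G)" "z \<in> range (\<lambda>l. lincomb k l G')"
      unfolding span_rows by blast+
    then obtain l l' where l: "z = lincomb k l G" and l': "z = lincomb k l' G'" by blast
    have e: "(\<Sum>i<k. l i * v j i) = (\<Sum>i<k. l' i * \<sigma> (v j) i)" for j
    proof -
      have "(\<Sum>i<k. l i * v j i) = z $ j" by (simp add: l lincomb_nth v_def)
      also have "\<dots> = (\<Sum>i<k. l' i * \<sigma> (v j) i)" by (simp add: l' lincomb_nth G'_def)
      finally show ?thesis .
    qed
    have "(\<Sum>i<k. l i * w i) = (\<Sum>i<k. l' i * \<sigma> w i)" if w: "w \<in> supported_vectors k" for w
    proof (cases "\<exists>i<k. w i \<noteq> 0")
      case True
      from simplex_matrix_columns_cover[OF G n this] obtain c j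
        where c: "c \<noteq> 0" "\<And>i. i < k \<Longrightarrow> w i = c * G i $ j" by metis
      have w: "w = (\<lambda>i. c * v j i)"
        using w c(2) by (auto simp: v_def supported_vectors_def fun_eq_iff)
      have "(\<Sum>i<k. l i * w i) = c * (\<Sum>i<k. l i * v j i)"
        by (simp add: w sum_distrib_left mult.left_commute)
      also have "\<dots> = (\<Sum>i<k. l' i * \<sigma> w i)"
        unfolding w e by (simp add: hom c(1) sum_distrib_left mult.left_commute)
      finally show ?thesis .
    next
      case False
      then have "w = (\<lambda>_. 0)"
        using w by (auto simp: supported_vectors_def fun_eq_iff not_less)
      then show ?thesis by (simp add: zero)
    qed
    then have "\<And>i. m \<le> i \<Longrightarrow> i < k \<Longrightarrow> l i = 0" by (rule sep)
    then have "z = lincomb m l G" unfolding l using m by (intro lincomb_truncate)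
    then show "z \<in> vec.span (G ` {..<m})" unfolding span_rows by blast
  next
    fix z assume z: "z \<in> vec.span (G ` {..<m})"
    have "G' ` {..<m} = G ` {..<m}"
      using m by (auto simp: G'_def top v_def vec_eq_iff intro!: image_cong)
    moreover have "vec.span (G ` {..<m}) \<subseteq> vec.span (G ` {..<k})"
      "vec.span (G' ` {..<m}) \<subseteq> vec.span (G' ` {..<k})"
      using m by (auto intro!: vec.span_mono)
    ultimately show "z \<in> vec.span (G ` {..<k}) \<inter> vec.span (G' ` {..<k})" using z by auto
  qed
  ultimately show ?thesis by blast
qed

definition two_point :: "nat \<Rightarrow> 'a \<Rightarrow> nat \<Rightarrow> 'a \<Rightarrow> nat \<Rightarrow> 'a::zero"
  where "two_point p c p' d i = (if i = p then c else if i = p' then d else 0)"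

lemma two_point_supported: "p < k \<Longrightarrow> p' < k \<Longrightarrow> two_point p c p' d \<in> supported_vectors k"
  by (auto simp: two_point_def supported_vectors_def)

lemma sum_two_point:
  fixes l :: "nat \<Rightarrow> 'a::field"
  assumes "p < k" "p' < k" "p \<noteq> p'"
  shows "(\<Sum>i<k. l i * two_point p c p' d i) = l p * c + l p' * d"
proof -
  have "(\<Sum>i<k. l i * two_point p c p' d i) =
    (\<Sum>i<k. (if i = p then l p * c else 0) + (if i = p' then l p' * d else 0))"
    using assms by (intro sum.cong) (auto simp: two_point_def)
  then show ?thesis using assms by (simp add: sum.distrib)
qed

lemma if_scale_cancel:
  "(if b then c * x else x) = (if b then c * y else y) \<Longrightarrow> c \<noteq> (0::'a::field) \<Longrightarrow> x = y"
  by (simp split: if_splits)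

lemma column_twist_scale_zero:
  fixes c :: "'a::field"
  assumes c: "c \<noteq> 0" "c \<noteq> 1" and k: "k \<ge> 2"
    and \<sigma>: "\<And>w i. \<sigma> w i =
      (if \<exists>p. w p \<noteq> 0 \<and> (\<forall>i'. i' \<noteq> p \<longrightarrow> w i' = 0) then c * w i else w i)"
  shows "column_twist k 0 \<sigma>"
proof -
  let ?P = "\<lambda>w :: nat \<Rightarrow> 'a. \<exists>p. w p \<noteq> 0 \<and> (\<forall>i'. i' \<noteq> p \<longrightarrow> w i' = 0)"
  have inj: "w = w'" if w: "w \<in> supported_vectors k" "w' \<in> supported_vectors k"
    and e: "\<forall>i<k. \<sigma> w i = \<sigma> w' i" for w w'
  proof -
    have "w i = 0 \<longleftrightarrow> w' i = 0" for i
    proof (cases "i < k")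
      case True
      then show ?thesis using e[rule_format, OF True] c(1) by (auto simp: \<sigma> split: if_splits)
    qed (use w in \<open>auto simp: supported_vectors_def\<close>)
    then have P: "?P w \<longleftrightarrow> ?P w'" by simp
    have "w i = w' i" for i
    proof (cases "i < k")
      case True
      show ?thesis using e[rule_format, OF True] c(1) unfolding \<sigma> P by (rule if_scale_cancel)
    qed (use w in \<open>auto simp: supported_vectors_def\<close>)
    then show ?thesis by blast
  qed
  have sep: "l p = 0" if e: "\<forall>w\<in>supported_vectors k. (\<Sum>i<k. l i * w i) = (\<Sum>i<k. l' i * \<sigma> w i)"
    and p: "p < k" for l l' p
  proof -
    obtain p' where p': "p' < k" "p' \<noteq> p" using k that[of "if p = 0 then 1 else 0"] by auto
    have "?P (two_point p 1 p' 0)" by (rule exI[of _ p]) (simp add: two_point_def)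
    then have "\<sigma> (two_point p 1 p' 0) = two_point p c p' 0"
      by (auto simp: \<sigma> two_point_def fun_eq_iff)
    then have 1: "l p = l' p * c"
      using e[rule_format, OF two_point_supported[OF p p'(1)], of 1 0] p p' by (simp add: sum_two_point)
    have two: "l p * d + l p' = l' p * d + l' p'" if d: "d \<noteq> 0" for d
    proof -
      have "\<not> ?P (two_point p d p' 1)"
      proof
        assume "?P (two_point p d p' 1)"
        then obtain r where r: "\<And>i. i \<noteq> r \<Longrightarrow> two_point p d p' 1 i = 0" by blast
        show False using r[of p] r[of p'] d p'(2) by (auto simp: two_point_def split: if_splits)
      qed
      then have "\<sigma> (two_point p d p' 1) = two_point p d p' 1" by (intro ext) (simp only: \<sigma> if_False)
      then show ?thesis
        using e[rule_format, OF two_point_supported[OF p p'(1)], of d 1] p p' by (simp add: sum_two_point)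
    qed
    have "(l p - l' p) * (c - 1) = (l p * c + l p') - (l p * 1 + l p') - ((l' p * c + l' p') - (l' p * 1 + l' p'))"
      by (simp add: algebra_simps)
    also have "\<dots> = 0" using two[of 1] two[OF c(1)] by simp
    finally have "l p = l' p" using c(2) by simp
    then have "l' p * (c - 1) = 0" using 1 by (simp add: algebra_simps)
    then show "l p = 0" using c(2) \<open>l p = l' p\<close> by simp
  qed
  show ?thesis
  proof (rule column_twistI)
    show "\<sigma> (\<lambda>i. d * w i) i = d * \<sigma> w i" if "d \<noteq> 0" for d w i
      using that by (auto simp: \<sigma> mult.left_commute)
    show "\<sigma> (\<lambda>_. 0) i = 0" for i by (simp add: \<sigma>)
  qed (use inj sep in auto)
qed

lemma column_twist_scale_pos:
  fixes c :: "'a::field"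
  assumes c: "c \<noteq> 0" "c \<noteq> 1" and m: "1 \<le> m"
    and \<sigma>: "\<And>w i. \<sigma> w i =
      (if m \<le> i \<and> w 0 \<noteq> 0 \<and> (\<forall>i'. 0 < i' \<and> i' < m \<longrightarrow> w i' = 0) then c * w i else w i)"
  shows "column_twist k m \<sigma>"
proof -
  let ?P = "\<lambda>w :: nat \<Rightarrow> 'a. w 0 \<noteq> 0 \<and> (\<forall>i'. 0 < i' \<and> i' < m \<longrightarrow> w i' = 0)"
  have inj: "w = w'" if w: "w \<in> supported_vectors k" "w' \<in> supported_vectors k"
    and e: "\<forall>i<k. \<sigma> w i = \<sigma> w' i" for w w'
  proof -
    have "w i = w' i" if i: "i < m" for i
    proof (cases "i < k")
      case True
      then show ?thesis using e[rule_format, OF True] i by (simp add: \<sigma>)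
    qed (use w in \<open>auto simp: supported_vectors_def\<close>)
    then have P: "(m \<le> i \<and> ?P w) = (m \<le> i \<and> ?P w')" for i using m by simp
    have "w i = w' i" for i
    proof (cases "i < k")
      case True
      show ?thesis using e[rule_format, OF True] c(1) unfolding \<sigma> P by (rule if_scale_cancel)
    qed (use w in \<open>auto simp: supported_vectors_def\<close>)
    then show ?thesis by blast
  qed
  have sep: "l p = 0" if e: "\<forall>w\<in>supported_vectors k. (\<Sum>i<k. l i * w i) = (\<Sum>i<k. l' i * \<sigma> w i)"
    and p: "m \<le> p" "p < k" for l l' p
  proof -
    have p0: "p \<noteq> 0" "0 < k" using p m by auto
    have s: "l 0 * a + l p * b = (\<Sum>i<k. l' i * \<sigma> (two_point 0 a p b) i)" for a b
      using e[rule_format, OF two_point_supported[OF p0(2) p(2)]] p0 p(2)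
        sum_two_point[OF p0(2) p(2), of l a b] by metis
    have "\<sigma> (two_point 0 1 p 0) = two_point 0 1 p 0" "\<sigma> (two_point 0 0 p 1) = two_point 0 0 p 1"
      "\<sigma> (two_point 0 1 p 1) = two_point 0 1 p c"
      using m p by (auto simp: \<sigma> two_point_def fun_eq_iff)
    then have "l 0 = l' 0" "l p = l' p" "l 0 + l p = l' 0 + l' p * c"
      using s[of 1 0] s[of 0 1] s[of 1 1] p0 p(2) by (simp_all add: sum_two_point)
    then have "l p * (c - 1) = 0" by (simp add: algebra_simps)
    then show ?thesis using c(2) by simp
  qed
  show ?thesis
  proof (rule column_twistI)
    show "\<sigma> (\<lambda>i. d * w i) i = d * \<sigma> w i" if "d \<noteq> 0" for d w i
      using that by (auto simp: \<sigma> mult.left_commute)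
    show "\<sigma> (\<lambda>_. 0) i = 0" for i by (simp add: \<sigma>)
    show "\<sigma> w i = w i" if "i < m" for w i using that by (simp add: \<sigma>)
  qed (use inj sep in blast)+
qed

text \<open>Entries are changed one at a time by functions of the other entries, which makes the map
  injective. The changes of the entries \<open>i \<ge> m\<close> must be linearly independent modulo linear forms:
  those of the first three entries use up the quadratic monomials in them, hence the cubic terms.\<close>

definition binary_twist :: "nat \<Rightarrow> (nat \<Rightarrow> 'a::field) \<Rightarrow> nat \<Rightarrow> 'a"
  where "binary_twist m w i =
    (let a = w 0 + (if m = 0 then w 1 * w 2 else 0);
         b = w 1 + (if m \<le> 1 then a * w 2 else 0)
     in if i = 0 then a else if i = 1 then b
        else if i = 2 then w 2 + (if m \<le> 2 then a * b else 0)
        else w i + (if m \<le> i then w (i - 1) * w (i - 2) * w (i - 3) else 0))"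

lemma binary_twist_simps:
  "binary_twist m w 0 = w 0 + (if m = 0 then w (Suc 0) * w 2 else 0)"
  "binary_twist m w (Suc 0) = w (Suc 0) + (if m \<le> 1 then binary_twist m w 0 * w 2 else 0)"
  "binary_twist m w 2 =
    w 2 + (if m \<le> 2 then binary_twist m w 0 * binary_twist m w (Suc 0) else 0)"
  "3 \<le> i \<Longrightarrow>
    binary_twist m w i = w i + (if m \<le> i then w (i - 1) * w (i - 2) * w (i - 3) else 0)"
  by (simp_all only: binary_twist_def Let_def) simp_all

lemma binary_twist_inj:
  assumes k: "k \<ge> 3" and w: "w \<in> supported_vectors k" "w' \<in> supported_vectors k"
    and e: "\<And>i. i < k \<Longrightarrow> binary_twist m w i = binary_twist m w' i"
  shows "w = w'"
proof
  have b: "binary_twist m w 0 = binary_twist m w' 0"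
    "binary_twist m w (Suc 0) = binary_twist m w' (Suc 0)"
    "binary_twist m w 2 = binary_twist m w' 2"
    using e k by simp_all
  have w2: "w 2 = w' 2"
    using b(3) unfolding binary_twist_simps(3) b(1,2) by simp
  have w1: "w (Suc 0) = w' (Suc 0)"
    using b(2) unfolding binary_twist_simps(2) b(1) w2 by simp
  have w0: "w 0 = w' 0"
    using b(1) unfolding binary_twist_simps(1) w1 w2 by simp
  show "w i = w' i" for i
  proof (induction i rule: less_induct)
    case (less i)
    consider "i = 0" | "i = 1" | "i = 2" | "i \<ge> k" | "i \<ge> 3" "i < k" by linarith
    then show ?case
    proof cases
      case 4
      then show ?thesis using w by (simp add: supported_vectors_def)
    next
      case 5
      then have "w (i - 1) = w' (i - 1)" "w (i - 2) = w' (i - 2)" "w (i - 3) = w' (i - 3)"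
        by (auto intro: less)
      then show ?thesis using e[of i] 5 by (simp add: binary_twist_simps(4) cong: if_cong)
    qed (use w0 w1 w2 in auto)
  qed
qed

lemma sum_first_three:
  fixes h :: "nat \<Rightarrow> 'a::comm_monoid_add"
  assumes "k \<ge> 3" "\<And>i. 3 \<le> i \<Longrightarrow> i < k \<Longrightarrow> h i = 0"
  shows "(\<Sum>i<k. h i) = h 0 + h 1 + h 2"
proof -
  have "(\<Sum>i<k. h i) = (\<Sum>i<3. h i)"
    by (rule sum.mono_neutral_right) (use assms in \<open>auto simp: not_less\<close>)
  then show ?thesis by (simp add: eval_nat_numeral add.assoc)
qed

lemma field_card_2:
  assumes "CARD('a::{field,finite}) = 2"
  shows "x = 0 \<or> x = (1::'a)" and "(2::'a) = 0"
proof -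
  have "{0, 1::'a} = UNIV" by (rule card_subset_eq) (use assms in auto)
  then show *: "x = 0 \<or> x = (1::'a)" for x by blast
  have "(1::'a) + 1 \<noteq> 1 + 0" by (simp only: add_left_cancel one_neq_zero not_False_eq_True)
  then show "(2::'a) = 0" using *[of 2] by (simp only: one_add_one add_0_right) blast
qed

lemma column_twist_binary:
  assumes q: "CARD('a::{field,finite}) = 2" and k: "k \<ge> 3"
  shows "column_twist k m (binary_twist m :: (nat \<Rightarrow> 'a) \<Rightarrow> nat \<Rightarrow> 'a)"
proof -
  let ?\<sigma> = "binary_twist m :: (nat \<Rightarrow> 'a) \<Rightarrow> nat \<Rightarrow> 'a"
  note q01 = field_card_2(1)[OF q] and two = field_card_2(2)[OF q]
  have sep: "l p = 0" if e: "\<forall>w\<in>supported_vectors k. (\<Sum>i<k. l i * w i) = (\<Sum>i<k. l' i * ?\<sigma> w i)"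
    and p: "m \<le> p" "p < k" for l l' p
  proof -
    have ll': "l r = l' r" if r: "r < k" for r
    proof -
      obtain r' where r': "r' < k" "r' \<noteq> r" using k that[of "if r = 0 then 1 else 0"] by auto
      let ?u = "two_point r 1 r' 0 :: nat \<Rightarrow> 'a"
      have prod: "?u a * ?u b = 0" if "a \<noteq> b" for a b
        using that by (simp add: two_point_def)
      have u0: "?\<sigma> ?u 0 = ?u 0" using prod[of "Suc 0" 2] by (simp add: binary_twist_simps(1))
      have u1: "?\<sigma> ?u (Suc 0) = ?u (Suc 0)"
        using prod[of 0 2] by (simp add: binary_twist_simps(2) u0)
      have u2: "?\<sigma> ?u 2 = ?u 2"
        using prod[of 0 "Suc 0"] by (simp add: binary_twist_simps(3) u0 u1)
      have "?\<sigma> ?u i = ?u i" for i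
      proof -
        consider "i = 0" | "i = Suc 0" | "i = 2" | "i \<ge> 3" by linarith
        then show ?thesis
        proof cases
          case 4
          then show ?thesis using prod[of "i - 1" "i - 2"] by (simp add: binary_twist_simps(4))
        qed (simp_all add: u0 u1 u2)
      qed
      then have "?\<sigma> ?u = ?u" by blast
      then show ?thesis
        using e[rule_format, OF two_point_supported[OF r r'(1)], of 1 0] r r'
        by (simp add: sum_two_point)
    qed
    have diff: "(\<Sum>i<k. l i * (?\<sigma> w i - w i)) = 0" if "w \<in> supported_vectors k" for w
    proof -
      have "(\<Sum>i<k. l i * ?\<sigma> w i) = (\<Sum>i<k. l i * w i)"
        using e that by (simp add: ll')
      then show ?thesis by (simp add: right_diff_distrib sum_subtractf)
    qed
    have low: "l 0 * (?\<sigma> w 0 - w 0) + l 1 * (?\<sigma> w 1 - w 1) + l 2 * (?\<sigma> w 2 - w 2) = 0"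
      if w: "w = two_point r 1 r' 1" "r < 3" "r' < 3" for w r r'
    proof -
      have "w \<in> supported_vectors k" using w k by (simp add: two_point_supported)
      moreover have "?\<sigma> w i = w i" if "3 \<le> i" for i
        using that w by (auto simp: binary_twist_simps(4) two_point_def)
      ultimately show ?thesis using diff[of w] k by (simp add: sum_first_three)
    qed
    have l2: "l 2 = 0" if "m \<le> 2"
      using low[OF refl, of 0 1] that by (simp add: binary_twist_simps two_point_def cong: if_cong)
    have l1: "l 1 = 0" if "m \<le> 1"
      using low[OF refl, of 0 2] that l2 by (simp add: binary_twist_simps two_point_def two cong: if_cong)
    have l0: "l 0 = 0" if "m = 0"
      using low[OF refl, of 1 2] that l2 l1 by (simp add: binary_twist_simps two_point_def two cong: if_cong)
    show ?thesis
    proof (cases "p < 3")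
      case True
      then consider "p = 0" | "p = 1" | "p = 2" by linarith
      then show ?thesis using p l0 l1 l2 by cases auto
    next
      case False
      define w :: "nat \<Rightarrow> 'a" where "w i = (if i < p \<and> p \<le> i + 3 then 1 else 0)" for i
      have "w \<in> supported_vectors k" using p by (simp add: w_def supported_vectors_def)
      then have "(\<Sum>i<k. l i * (?\<sigma> w i - w i)) = 0" by (rule diff)
      moreover have "l i * (?\<sigma> w i - w i) = (if i = p then l p else 0)" for i
      proof (cases "i < 3")
        case True
        then consider "i = 0" | "i = 1" | "i = 2" by linarith
        then show ?thesis using False l0 l1 l2
          by cases (auto simp: binary_twist_simps)
      next
        case i: False
        have "w (i - 1) * w (i - 2) * w (i - 3) = (if i = p then 1 else 0)"
          using i False by (auto simp: w_def)
        then show ?thesis using i p(1) by (cases "i = p") (simp_all add: binary_twist_simps(4) cong: if_cong)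
      qed
      ultimately show ?thesis using p by simp
    qed
  qed
  have top: "?\<sigma> w i = w i" if "i < m" for w i
  proof -
    consider "i = 0" | "i = Suc 0" | "i = 2" | "i \<ge> 3" by linarith
    then show ?thesis using that by cases (simp_all add: binary_twist_simps)
  qed
  have hom: "?\<sigma> (\<lambda>i. c * w i) i = c * ?\<sigma> w i" if "c \<noteq> 0" for c w i
    using q01[of c] that by auto
  have zero: "?\<sigma> (\<lambda>_. 0) i = 0" for i by (simp add: binary_twist_def Let_def)
  show ?thesis
    by (rule column_twistI) (use sep top hom zero binary_twist_inj[OF k] in \<open>blast+\<close>)
qed

lemma column_twist_exists:
  assumes k: "k \<ge> 2" and q: "\<not> (CARD('a::{field,finite}) = 2 \<and> k = 2)"
  shows "\<exists>\<sigma> :: (nat \<Rightarrow> 'a) \<Rightarrow> nat \<Rightarrow> 'a. column_twist k m \<sigma>"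
proof (cases "CARD('a) = 2")
  case True
  then show ?thesis using k q column_twist_binary[OF True, of k m] by auto
next
  case False
  have "card {0, 1::'a} < CARD('a)" using CARD_field_ge_2[where 'a='a] False by simp
  then obtain c :: 'a where "c \<notin> {0, 1}" by (metis UNIV_I subsetI subset_antisym less_irrefl subset_UNIV equalityI)
  then have c: "c \<noteq> 0" "c \<noteq> 1" by auto
  show ?thesis
  proof (cases "m = 0")
    case True
    show ?thesis unfolding True by (rule exI, rule column_twist_scale_zero[OF c k], rule refl)
  next
    case False
    then have "1 \<le> m" by simp
    show ?thesis by (rule exI, rule column_twist_scale_pos[OF c \<open>1 \<le> m\<close>], rule refl)
  qed
qed

theorem theorem1:
  fixes X :: "('a::{field,finite} ^ 'n::finite) set"
    and q k m N :: nat
  assumes "q = CARD('a)"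
    and "k \<ge> 2"
    and "CARD('n) = q_number q k"
    and "m < k"
    and "N = q_number q (k - m)"
    and "vec.subspace X"
    and "vec.dim X = m"
    and "\<exists>C. simplex_code k C \<and> X \<subseteq> C"
  shows "real (card {C. simplex_code k C \<and> X \<subseteq> C}) =
      fact N * (real q - 1) ^ N * fact (q ^ (k - m)) ^ q_number q m /
      ((\<Prod>i<k - m. real q ^ (k - m) - real q ^ i) * real q ^ (m * (k - m)))
    \<and> (\<not> (q = 2 \<and> k = 2) \<longrightarrow>
        (\<exists>C C'. simplex_code k C \<and> simplex_code k C' \<and> C \<inter> C' = X))"
proof -
  let ?D = "{C. simplex_code k C \<and> X \<subseteq> C}"
  have n: "CARD('n) = q_number CARD('a) k" and mk: "m \<le> k" using assms by auto
  have q2: "q \<ge> 2" using assms(1) CARD_field_ge_2 by simp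
  obtain x where x: "rows_independent m x" "vec.span (x ` {..<m}) = X"
    using rows_of_subspace[OF assms(6)] assms(7) by metis
  obtain C where "simplex_code k C" "vec.span (x ` {..<m}) \<subseteq> C" using assms(8) x by blast
  then obtain G where G: "G \<in> simplex_completions x m k" and C: "vec.span (G ` {..<k}) = C"
    using simplex_completion_exists[OF x(1) _ _ mk] by metis
  have "card ?D * (\<Prod>i=m..<k. q ^ k - q ^ i) =
      fact N * (q - 1) ^ N * fact (q ^ (k - m)) ^ q_number q m"
    using card_simplex_completions[OF G n assms(4,1,5)]
      card_simplex_completions_eq_card_codes[OF x(1) n mk] x(2) assms(1) by simp
  then have "real (card ?D * (\<Prod>i=m..<k. q ^ k - q ^ i)) =
      real (fact N * (q - 1) ^ N * fact (q ^ (k - m)) ^ q_number q m)" by simp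
  then have count: "real (card ?D) * (\<Prod>i=m..<k. real (q ^ k - q ^ i)) =
      fact N * (real q - 1) ^ N * fact (q ^ (k - m)) ^ q_number q m"
    using q2 by (simp add: of_nat_diff)
  have P: "(\<Prod>i=m..<k. real (q ^ k - q ^ i)) =
      (\<Prod>i<k - m. real q ^ (k - m) - real q ^ i) * real q ^ (m * (k - m))"
  proof -
    have "(\<Prod>i=m..<k. real (q ^ k - q ^ i)) = (\<Prod>i<k - m. real (q ^ k - q ^ (m + i)))"
      by (simp add: prod.atLeastLessThan_shift_0[of _ m k] atLeast0LessThan)
    also have "\<dots> = (\<Prod>i<k - m. (real q ^ (k - m) - real q ^ i) * real q ^ m)"
    proof (rule prod.cong[OF refl])
      fix i assume "i \<in> {..<k - m}"
      then have "q ^ (m + i) \<le> q ^ k" using q2 by (intro power_increasing) auto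
      then have "real (q ^ k - q ^ (m + i)) = real q ^ k - real q ^ (m + i)"
        by (simp add: of_nat_diff)
      also have "real q ^ k = real q ^ (k - m) * real q ^ m"
        using mk by (simp flip: power_add)
      finally show "real (q ^ k - q ^ (m + i)) = (real q ^ (k - m) - real q ^ i) * real q ^ m"
        by (simp add: power_add algebra_simps)
    qed
    also have "\<dots> = (\<Prod>i<k - m. real q ^ (k - m) - real q ^ i) * real q ^ (m * (k - m))"
      by (simp add: prod.distrib power_mult)
    finally show ?thesis .
  qed
  have "(\<Prod>i=m..<k. real (q ^ k - q ^ i)) \<noteq> 0"
    using q2 by (auto simp: prod_zero_iff not_le intro!: power_strict_increasing)
  then have "real (card ?D) =
      fact N * (real q - 1) ^ N * fact (q ^ (k - m)) ^ q_number q m /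
      ((\<Prod>i<k - m. real q ^ (k - m) - real q ^ i) * real q ^ (m * (k - m)))"
    using count unfolding P by (rule nonzero_eq_divide_eq[THEN iffD2])
  moreover have "\<exists>C C'. simplex_code k C \<and> simplex_code k C' \<and> C \<inter> C' = X"
    if "\<not> (q = 2 \<and> k = 2)"
  proof -
    have Gs: "simplex_matrix k G" and "G ` {..<m} = x ` {..<m}"
      using G by (auto simp: simplex_completions_def)
    have "\<exists>\<sigma> :: (nat \<Rightarrow> 'a) \<Rightarrow> nat \<Rightarrow> 'a. column_twist k m \<sigma>"
      using that assms(1,2) by (intro column_twist_exists) simp_all
    then obtain \<sigma> :: "(nat \<Rightarrow> 'a) \<Rightarrow> nat \<Rightarrow> 'a" where "column_twist k m \<sigma>" ..
    then obtain G' where "simplex_matrix k G'"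
      "vec.span (G ` {..<k}) \<inter> vec.span (G' ` {..<k}) = vec.span (G ` {..<m})"
      using column_twist_codes[OF _ Gs n mk, of \<sigma>] by blast
    then show ?thesis
      using simplex_code_span_rows[OF Gs n] simplex_code_span_rows[of k G', OF _ n]
        x(2) \<open>G ` {..<m} = x ` {..<m}\<close> by metis
  qed
  ultimately show ?thesis by blast
qed

end
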